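(* Let $(Z_n)$ be a critical Galton–Watson process (with $Z_0=1$) with infinite offspring variance such that $$E(s^{Z_1})=s+(1-s)^{\alpha}L(1-s),\qquad s\in[0,1),$$ where $\alpha\in(1,2]$ and $L(t)$ is slowly varying as $t\to 0$. Let $T^*$ be the tree associated with the process $(Z_n)$ conditioned to survive forever. Then $T^*$ almost surely has the infinite collision property.
   Context: Critical means $E(Z_1)=1$. Let $p_k=P(Z_1=k)$. The tree $T^*$ conditioned to survive forever is the random tree constructed as follows: the root has a random number of offspring with the size-biased law $P(\cdot=k)=kp_k$; one of its offspring, chosen uniformly at random, again receives an independent size-biased number of offspring, one of which is chosen uniformly, and so on indefinitely; every offspring that is not chosen is the root of an independent (unconditioned) Galton–Watson tree with offspring distribution $(p_k)$. Infinite collision property: for a connected graph $G$, let $X,Y$ be independent discrete-time simple random walks on $G$ and let $P_{a,b}$ be their joint law when $X_0=a$, $Y_0=b$. $G$ has the infinite collision property if $P_{a,a}(X_t=Y_t\text{ for infinitely many }t)=1$ for all vertices $a$. *)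

theory Defs
  imports "HOL-Probability.Probability"
begin

text \<open>Galton--Watson processes with offspring law \<open>p\<close>, driven by i.i.d. offspring numbers
  \<open>\<xi> n i\<close> (the number of children of the \<open>i\<close>-th individual of generation \<open>n\<close>).\<close>

definition galton_watson :: "'a measure \<Rightarrow> nat pmf \<Rightarrow> (nat \<Rightarrow> 'a \<Rightarrow> nat) \<Rightarrow> bool" where
  "galton_watson M p Z \<longleftrightarrow> prob_space M \<and>
     (\<exists>\<xi> :: nat \<Rightarrow> nat \<Rightarrow> 'a \<Rightarrow> nat.
        prob_space.indep_vars M (\<lambda>_. count_space UNIV) (\<lambda>(n, i). \<xi> n i) UNIV \<and>
        (\<forall>n i. distr M (count_space UNIV) (\<xi> n i) = measure_pmf p) \<and>
        (\<forall>\<omega>\<in>space M. Z 0 \<omega> = 1 \<and> (\<forall>n. Z (Suc n) \<omega> = (\<Sum>i<Z n \<omega>. \<xi> n i \<omega>))))"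

definition slowly_varying_at_0 :: "(real \<Rightarrow> real) \<Rightarrow> bool" where
  "slowly_varying_at_0 L \<longleftrightarrow>
     (\<exists>\<delta>>0. L \<in> borel_measurable (restrict_space borel {0<..<\<delta>}) \<and> (\<forall>t\<in>{0<..<\<delta>}. L t > 0)) \<and>
     (\<forall>c>0. ((\<lambda>t. L (c * t) / L t) \<longlongrightarrow> 1) (at_right 0))"

text \<open>A graph is given by a vertex set \<open>V\<close> and an adjacency relation, of which only the
  restriction to \<open>V\<close> matters.\<close>

definition nbrs :: "'v set \<Rightarrow> ('v \<Rightarrow> 'v \<Rightarrow> bool) \<Rightarrow> 'v \<Rightarrow> 'v set" where
  "nbrs V adj v = {w \<in> V. adj v w}"

text \<open>The simple random walk is realised by independent choices \<open>\<xi> (t, v)\<close> of a uniform neighbour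
  of \<open>v\<close>, the walk moving to \<open>\<xi> (t, v)\<close> if it is at \<open>v\<close> at time \<open>t\<close>. This is meaningful when every
  vertex has finitely many, and at least one, neighbours; see \<open>measure_srw_cylinder\<close> below for the
  resulting finite-dimensional distributions.\<close>

primrec srw_path :: "'v \<Rightarrow> (nat \<times> 'v \<Rightarrow> 'v) \<Rightarrow> nat \<Rightarrow> 'v" where
  "srw_path a \<xi> 0 = a"
| "srw_path a \<xi> (Suc t) = \<xi> (t, srw_path a \<xi> t)"

definition srw_choices :: "'v set \<Rightarrow> ('v \<Rightarrow> 'v \<Rightarrow> bool) \<Rightarrow> (nat \<times> 'v \<Rightarrow> 'v) measure" where
  "srw_choices V adj = (\<Pi>\<^sub>M (t, v)\<in>UNIV. measure_pmf (pmf_of_set (nbrs V adj v)))"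

definition srw :: "'v::countable set \<Rightarrow> ('v \<Rightarrow> 'v \<Rightarrow> bool) \<Rightarrow> 'v \<Rightarrow> (nat \<Rightarrow> 'v) measure" where
  "srw V adj a = distr (srw_choices V adj) (\<Pi>\<^sub>M t\<in>UNIV. count_space UNIV) (srw_path a)"

definition infinite_collision_property :: "'v::countable set \<Rightarrow> ('v \<Rightarrow> 'v \<Rightarrow> bool) \<Rightarrow> bool" where
  "infinite_collision_property V adj \<longleftrightarrow>
     (\<forall>a\<in>V. AE (X, Y) in srw V adj a \<Otimes>\<^sub>M srw V adj a. infinite {t. X t = Y t})"

text \<open>Plane trees in Ulam--Harris notation: the root is \<open>[]\<close>, the children of \<open>u\<close> are \<open>u @ [k]\<close>
  with \<open>k < c u\<close>.\<close>

inductive_set uh_tree :: "(nat list \<Rightarrow> nat) \<Rightarrow> nat list set" for c :: "nat list \<Rightarrow> nat" where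
  root: "[] \<in> uh_tree c"
| child: "u \<in> uh_tree c \<Longrightarrow> k < c u \<Longrightarrow> u @ [k] \<in> uh_tree c"

definition uh_adj :: "nat list \<Rightarrow> nat list \<Rightarrow> bool" where
  "uh_adj u v \<longleftrightarrow> (\<exists>k. v = u @ [k] \<or> u = v @ [k])"

text \<open>A probability mass function only if \<open>p\<close> has mean 1; see \<open>pmf_size_biased\<close>.\<close>

definition size_biased :: "nat pmf \<Rightarrow> nat pmf" where
  "size_biased p = embed_pmf (\<lambda>k. real k * pmf p k)"

definition spine_pmf :: "nat pmf \<Rightarrow> (nat \<times> nat) pmf" where
  "spine_pmf p = bind_pmf (size_biased p) (\<lambda>k. map_pmf (Pair k) (pmf_of_set {..<k}))"

text \<open>A sample is a pair \<open>(\<sigma>, \<omega>)\<close>: \<open>\<sigma> n\<close> consists of the number of children of the \<open>n\<close>-th spine vertex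
  and the index of the chosen child; \<open>\<omega> u\<close> is the number of children of \<open>u\<close> if \<open>u\<close> is off the spine.\<close>

definition surviving_space :: "nat pmf \<Rightarrow> ((nat \<Rightarrow> nat \<times> nat) \<times> (nat list \<Rightarrow> nat)) measure" where
  "surviving_space p =
     (\<Pi>\<^sub>M n\<in>UNIV. measure_pmf (spine_pmf p)) \<Otimes>\<^sub>M (\<Pi>\<^sub>M u\<in>UNIV. measure_pmf p)"

definition spine :: "(nat \<Rightarrow> nat \<times> nat) \<Rightarrow> nat \<Rightarrow> nat list" where
  "spine \<sigma> n = map (\<lambda>i. snd (\<sigma> i)) [0..<n]"

definition surviving_tree :: "(nat \<Rightarrow> nat \<times> nat) \<times> (nat list \<Rightarrow> nat) \<Rightarrow> nat list set" where
  "surviving_tree = (\<lambda>(\<sigma>, \<omega>).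
     uh_tree (\<lambda>u. if u = spine \<sigma> (length u) then fst (\<sigma> (length u)) else \<omega> u))"

lemma pmf_size_biased:
  assumes "measure_pmf.expectation p real = 1"
  shows "pmf (size_biased p) k = real k * pmf p k"
proof -
  have int: "integrable (measure_pmf p) real"
    using assms not_integrable_integral_eq by fastforce
  have "(\<integral>\<^sup>+k. ennreal (real k * pmf p k) \<partial>count_space UNIV) = (\<integral>\<^sup>+k. ennreal (real k) \<partial>measure_pmf p)"
    by (simp add: nn_integral_measure_pmf ennreal_mult mult.commute)
  also have "\<dots> = 1"
    using int assms by (subst nn_integral_eq_integral) auto
  finally show ?thesis
    unfolding size_biased_def by (intro pmf_embed_pmf) auto
qed

lemma srw_path_measurable:
  fixes a :: "'v::countable"
  shows "srw_path a \<in> measurable (srw_choices V adj) (\<Pi>\<^sub>M t\<in>UNIV. count_space UNIV)"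
proof -
  have comp: "(\<lambda>\<xi>. \<xi> (t, v)) \<in> measurable (srw_choices V adj) (count_space UNIV)" for t :: nat and v
    unfolding srw_choices_def
    using measurable_component_singleton[of "(t, v)" UNIV
        "\<lambda>(t, v). measure_pmf (pmf_of_set (nbrs V adj v))"]
    by simp
  have "(\<lambda>\<xi>. srw_path a \<xi> t) \<in> measurable (srw_choices V adj) (count_space UNIV)" for t
  proof (induction t)
    case (Suc t)
    show ?case
      using measurable_compose_countable[OF comp Suc] by simp
  qed simp
  then show ?thesis
    by (intro measurable_PiM_single') auto
qed

lemma measure_srw_cylinder:
  fixes x :: "nat \<Rightarrow> 'v::countable"
  shows "measure (srw V adj (x 0)) {X. \<forall>t\<le>n. X t = x t}
       = (\<Prod>t<n. pmf (pmf_of_set (nbrs V adj (x t))) (x (Suc t)))"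
proof -
  let ?P = "\<lambda>i :: nat \<times> 'v. measure_pmf (pmf_of_set (nbrs V adj (snd i)))"
  interpret product_prob_space ?P UNIV
    by unfold_locales
  have ch: "srw_choices V adj = PiM UNIV ?P"
    by (simp add: srw_choices_def case_prod_unfold)
  let ?J = "(\<lambda>t. (t, x t)) ` {..<n}"
  have path: "(\<forall>t\<le>n. srw_path (x 0) \<xi> t = x t) \<longleftrightarrow> (\<forall>t<n. \<xi> (t, x t) = x (Suc t))" for \<xi>
  proof (induction n)
    case (Suc n)
    then show ?case
      by (auto simp: le_Suc_eq less_Suc_eq)
  qed simp
  have "{X. \<forall>t\<le>n. X t = x t} \<in> sets (\<Pi>\<^sub>M t\<in>UNIV. count_space (UNIV :: 'v set))"
  proof -
    have "Measurable.pred (\<Pi>\<^sub>M t\<in>UNIV. count_space (UNIV :: 'v set)) (\<lambda>X. \<forall>t\<in>{..n}. X t = x t)"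
      by measurable
    then show ?thesis
      by (simp add: pred_def space_PiM Ball_def)
  qed
  then have "measure (srw V adj (x 0)) {X. \<forall>t\<le>n. X t = x t}
      = measure (PiM UNIV ?P) {\<xi>. \<forall>t<n. \<xi> (t, x t) = x (Suc t)}"
    unfolding srw_def
    by (subst measure_distr[OF srw_path_measurable]) (auto simp: ch space_PiM path vimage_def)
  also have "{\<xi>. \<forall>t<n. \<xi> (t, x t) = x (Suc t)}
      = prod_emb UNIV ?P ?J (Pi\<^sub>E ?J (\<lambda>i. {x (Suc (fst i))}))"
    by (auto simp: prod_emb_def PiE_iff)
  also have "measure (PiM UNIV ?P) \<dots> = (\<Prod>i\<in>?J. measure (?P i) {x (Suc (fst i))})"
    by (intro measure_PiM_emb) auto
  also have "\<dots> = (\<Prod>t<n. pmf (pmf_of_set (nbrs V adj (x t))) (x (Suc t)))"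
    by (subst prod.reindex) (auto simp: inj_on_def measure_pmf_single)
  finally show ?thesis .
qed

lemma finite_nbrs_uh_tree: "finite (nbrs (uh_tree c) uh_adj u)"
proof (rule finite_subset)
  show "nbrs (uh_tree c) uh_adj u \<subseteq> insert (butlast u) ((\<lambda>k. u @ [k]) ` {..<c u})"
    by (auto simp: nbrs_def uh_adj_def elim: uh_tree.cases)
qed auto

lemma uh_tree_connected:
  "u \<in> uh_tree c \<Longrightarrow> (\<lambda>v w. w \<in> nbrs (uh_tree c) uh_adj v)\<^sup>*\<^sup>* [] u"
proof (induction rule: uh_tree.induct)
  case (child u k)
  then show ?case
    by (auto simp: nbrs_def uh_adj_def intro!: uh_tree.child intro: rtranclp.rtrancl_into_rtrancl)
qed auto

end

theory Submission
  imports Defs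
begin

text \<open>
  Directed towards the infinite end of its spine, \<open>T\<^sup>*\<close> is a one-ended tree. For a finite set \<open>B\<close> closed
  under passing to descendants, let \<open>g\<^sub>B x y\<close> be the number of vertices of \<open>B\<close> lying on both rays from
  \<open>x\<close> and from \<open>y\<close> to the end; this is the Green function, divided by the degree, of the walk killed
  outside \<open>B\<close>, and it is harmonic for the pair of walks until they meet or leave \<open>B\<close>. Hence the walks
  meet with probability at least \<open>g\<^sub>B x y / max\<^sub>z g\<^sub>B z z\<close>. Taking for \<open>B\<close> everything hanging off the
  first \<open>n\<close> spine vertices, this is bounded below uniformly in \<open>x\<close> and \<open>y\<close> as soon as, for infinitely
  many \<open>n\<close>, the bushes there have height \<open>O(n)\<close>; a uniform lower bound forces infinitely many collisions.

  The heights are controlled by a union bound. With \<open>f\<close> the generating function and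
  \<open>\<phi> q = f (1 - q) - (1 - q)\<close>, the probability \<open>q\<^sub>m\<close> that a Galton--Watson tree reaches height \<open>m\<close>
  satisfies \<open>q\<^sub>m\<^sub>+\<^sub>1 = q\<^sub>m - \<phi> q\<^sub>m\<close>, and a bush on the spine reaches height \<open>m\<close> with probability at most
  \<open>4 \<phi> q\<^sub>m / q\<^sub>m\<close>. Regular variation with index \<open>\<alpha> > 1\<close> gives \<open>\<phi> (q / 2) \<le> \<theta> \<phi> q\<close> for small \<open>q\<close> with
  some \<open>\<theta> < 1/2\<close>, whence \<open>\<phi> q\<^sub>m / q\<^sub>m = O(1/m)\<close> by convexity. So some bush among the first \<open>n\<close> is higher
  than \<open>D n\<close> with probability \<open>O(1/D)\<close>, uniformly in \<open>n\<close>.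
\<close>

section \<open>Pairs of random walks\<close>

text \<open>The law of the first \<open>n + 1\<close> positions, as a discrete law on lists.
  Conditioning on the first step becomes a defining equation, so that facts about the walks follow
  by induction on the horizon, without the infinite product behind \<open>srw\<close>.\<close>

primrec walk_pmf :: "'v set \<Rightarrow> ('v \<Rightarrow> 'v \<Rightarrow> bool) \<Rightarrow> nat \<Rightarrow> 'v \<Rightarrow> 'v list pmf" where
  "walk_pmf V adj 0 a = return_pmf [a]"
| "walk_pmf V adj (Suc n) a =
     bind_pmf (pmf_of_set (nbrs V adj a)) (\<lambda>b. map_pmf ((#) a) (walk_pmf V adj n b))"

lemma set_pmf_walk_pmf: "xs \<in> set_pmf (walk_pmf V adj n a) \<Longrightarrow> length xs = Suc n \<and> xs ! 0 = a"
  by (induction n arbitrary: a xs) auto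

lemma pmf_map_Cons: "pmf (map_pmf ((#) a) q) (b # xs) = (if a = b then pmf q xs else 0)"
proof (cases "a = b")
  case True
  then show ?thesis
    by (simp add: pmf_map_inj')
next
  case False
  then have "b # xs \<notin> set_pmf (map_pmf ((#) a) q)"
    by auto
  then show ?thesis
    using False by (subst (asm) set_pmf_iff) simp
qed

lemma pmf_walk_pmf:
  assumes "length xs = Suc n"
  shows "pmf (walk_pmf V adj n a) xs =
    (if xs ! 0 = a then \<Prod>t<n. pmf (pmf_of_set (nbrs V adj (xs ! t))) (xs ! Suc t) else 0)"
  using assms
proof (induction n arbitrary: a xs)
  case 0
  then show ?case
    by (auto simp: length_Suc_conv)
next
  case (Suc n)
  then obtain b ys where xs: "xs = b # ys" and ys: "length ys = Suc n"
    by (metis length_Suc_conv)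
  let ?q = "pmf_of_set (nbrs V adj a)"
  let ?c = "\<Prod>t<n. pmf (pmf_of_set (nbrs V adj (ys ! t))) (ys ! Suc t)"
  have "pmf (walk_pmf V adj (Suc n) a) xs =
      (\<integral>c. (if a = b then ?c else 0) * indicator {ys ! 0} c \<partial>measure_pmf ?q)"
    unfolding walk_pmf.simps pmf_bind xs pmf_map_Cons
    by (intro Bochner_Integration.integral_cong) (auto simp: Suc.IH[OF ys] simp del: nth_Cons_0)
  also have "\<dots> = (if a = b then ?c else 0) * pmf ?q (ys ! 0)"
    by (simp add: measure_pmf_single)
  finally show ?case
    using xs by (simp add: prod.lessThan_Suc_shift mult.commute del: prod.lessThan_Suc)
qed

lemma srw_space_sets:
  "space (srw V adj a) = UNIV"
  "sets (srw V adj a) = sets (\<Pi>\<^sub>M t\<in>UNIV. count_space (UNIV :: 'v::countable set))"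
  for a :: "'v::countable"
  by (auto simp: srw_def space_PiM)

lemma prob_space_srw: "prob_space (srw V adj a)"
proof -
  have "prob_space (srw_choices V adj)"
    unfolding srw_choices_def by (intro prob_space_PiM) (auto intro: prob_space_measure_pmf)
  then show ?thesis
    unfolding srw_def by (intro prob_space.prob_space_distr srw_path_measurable)
qed

lemma measurable_path_prefix [measurable]:
  "(\<lambda>X :: nat \<Rightarrow> 'v::countable. map X [0..<n]) \<in> 
     (\<Pi>\<^sub>M t\<in>UNIV. count_space UNIV) \<rightarrow>\<^sub>M count_space UNIV"
proof (induction n)
  case (Suc n)
  note [measurable] = Suc
  have "(\<lambda>X :: nat \<Rightarrow> 'v. map X [0..<n] @ [X n]) \<in> 
     (\<Pi>\<^sub>M t\<in>UNIV. count_space UNIV) \<rightarrow>\<^sub>M count_space UNIV"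
    by measurable
  then show ?case by simp
qed simp

lemma AE_srw_0: "AE X in srw V adj a. X 0 = a"
  unfolding srw_def by (subst AE_distr_iff[OF srw_path_measurable]) auto

text \<open>Lists form a countable set, so comparing singletons is enough.
  \<open>measure_srw_cylinder\<close> covers lists of the right length and starting point; all
  others are null on both sides.\<close>

lemma distr_srw_prefix:
  fixes a :: "'v::countable"
  shows "distr (srw V adj a) (count_space UNIV) (\<lambda>X. map X [0..<Suc n])
       = measure_pmf (walk_pmf V adj n a)"
proof (rule measure_eqI_countable[where A = UNIV])
  interpret prob_space "srw V adj a" by (rule prob_space_srw)
  have meas: "(\<lambda>X. map X [0..<Suc n]) \<in> srw V adj a \<rightarrow>\<^sub>M count_space UNIV"
    using measurable_path_prefix[of "Suc n"]
    by (subst measurable_cong_sets[OF srw_space_sets(2) refl])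
  fix xs :: "'v list"
  let ?A = "{X :: nat \<Rightarrow> 'v. map X [0..<Suc n] = xs}"
  have "emeasure (distr (srw V adj a) (count_space UNIV) (\<lambda>X. map X [0..<Suc n])) {xs} =
     emeasure (srw V adj a) ?A"
    by (subst emeasure_distr[OF meas]) (auto simp: srw_space_sets vimage_def)
  also have "\<dots> = ennreal (measure (srw V adj a) ?A)"
    by (simp add: emeasure_eq_measure)
  also have "measure (srw V adj a) ?A = pmf (walk_pmf V adj n a) xs"
  proof (cases "length xs = Suc n \<and> xs ! 0 = a")
    case True
    have "?A = {X. \<forall>t\<le>n. X t = xs ! t}"
      using True by (auto simp: list_eq_iff_nth_eq less_Suc_eq_le simp del: upt_Suc)
    then show ?thesis
      using measure_srw_cylinder[of V adj "\<lambda>t. xs ! t" n] True pmf_walk_pmf[of xs n V adj a]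
      by simp
  next
    case False
    then have "xs \<notin> set_pmf (walk_pmf V adj n a)"
      using set_pmf_walk_pmf by fastforce
    moreover have "AE X in srw V adj a. X \<notin> ?A"
      using AE_srw_0
    proof eventually_elim
      case (elim X)
      then show ?case
        using False by (auto simp del: upt_Suc)
    qed
    then have "measure (srw V adj a) ?A = 0"
      using prob_eq_0_AE[of "\<lambda>X. X \<in> ?A"] by (simp add: srw_space_sets del: upt_Suc)
    ultimately show ?thesis
      by (simp add: set_pmf_iff)
  qed
  finally show "emeasure (distr (srw V adj a) (count_space UNIV) (\<lambda>X. map X [0..<Suc n])) {xs} =
     emeasure (measure_pmf (walk_pmf V adj n a)) {xs}"
    by (simp add: emeasure_pmf_single)
qed auto

section \<open>The transition operator of the pair of walks and the probability of not
  meeting\<close>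

definition pair_avg :: "'v set \<Rightarrow> ('v \<Rightarrow> 'v \<Rightarrow> bool) \<Rightarrow> ('v \<Rightarrow> 'v \<Rightarrow> real) \<Rightarrow> 'v \<Rightarrow> 'v \<Rightarrow> real" where
  "pair_avg V adj F x y = (\<Sum>x'\<in>nbrs V adj x. \<Sum>y'\<in>nbrs V adj y. F x' y') /
     (real (card (nbrs V adj x)) * real (card (nbrs V adj y)))"

text \<open>The probability that walks from \<open>x\<close> and \<open>y\<close> do not meet at
  times \<open>0, ..., m\<close> (see \<open>measure_avoid\<close>), given by its first-step
  recursion.\<close>

primrec avoid :: "'v set \<Rightarrow> ('v \<Rightarrow> 'v \<Rightarrow> bool) \<Rightarrow> nat \<Rightarrow> 'v \<Rightarrow> 'v \<Rightarrow> real" where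
  "avoid V adj 0 x y = (if x = y then 0 else 1)"
| "avoid V adj (Suc m) x y = (if x = y then 0 else pair_avg V adj (avoid V adj m) x y)"

definition noncoll :: "nat \<Rightarrow> nat \<Rightarrow> ('v list \<times> 'v list) set" where
  "noncoll n m = {(xs, ys). \<forall>t\<in>{n..n + m}. xs ! t \<noteq> ys ! t}"

lemma pair_walk_pmf_Suc:
  "pair_pmf (walk_pmf V adj (Suc n) a) (walk_pmf V adj (Suc n) b) =
   bind_pmf (pair_pmf (pmf_of_set (nbrs V adj a)) (pmf_of_set (nbrs V adj b)))
     (\<lambda>(x, y). map_pmf (\<lambda>(xs, ys). (a # xs, b # ys)) (pair_pmf (walk_pmf V adj n x) (walk_pmf V adj n y)))"
  apply (simp add: pair_pmf_def map_pmf_def bind_assoc_pmf bind_return_pmf)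
  apply (intro bind_pmf_cong refl)
  apply (subst bind_commute_pmf)
  apply (intro bind_pmf_cong refl)
  done

lemma measure_pair_uniform_bind:
  assumes "finite A" "A \<noteq> {}" "finite B" "B \<noteq> {}"
  shows "measure (measure_pmf (bind_pmf (pair_pmf (pmf_of_set A) (pmf_of_set B)) (\<lambda>(x, y). K x y))) S
    = (\<Sum>x\<in>A. \<Sum>y\<in>B. measure (measure_pmf (K x y)) S) / (real (card A) * real (card B))"
proof -
  have *: "pair_pmf (pmf_of_set A) (pmf_of_set B) = pmf_of_set (A \<times> B)"
  proof (rule pmf_eqI)
    fix i show "pmf (pair_pmf (pmf_of_set A) (pmf_of_set B)) i = pmf (pmf_of_set (A \<times> B)) i"
      using assms by (cases i) (simp add: pmf_pair indicator_def)
  qed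
  have "measure (measure_pmf (bind_pmf (pmf_of_set (A \<times> B)) (\<lambda>(x, y). K x y))) S =
    (\<integral>z. measure (measure_pmf (case z of (x, y) \<Rightarrow> K x y)) S \<partial>measure_pmf (pmf_of_set (A \<times> B)))"
    unfolding measure_pmf_bind
    by (subst measure_pmf.measure_bind[where N = "count_space UNIV"])
      (auto intro!: measurable_measure_pmf simp: space_subprob_algebra intro: prob_space_imp_subprob_space prob_space_measure_pmf)
  also have "\<dots> = (\<Sum>z\<in>A\<times>B. measure (measure_pmf (case z of (x, y) \<Rightarrow> K x y)) S) / real (card (A \<times> B))"
    using assms by (subst integral_pmf_of_set) auto
  finally show ?thesis
    by (simp add: * sum.cartesian_product card_cartesian_product case_prod_unfold)
qed

lemma measure_pair_walk_pmf_Suc: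
  assumes "finite (nbrs V adj a)" "nbrs V adj a \<noteq> {}" "finite (nbrs V adj b)" "nbrs V adj b \<noteq> {}"
  shows "measure (measure_pmf (pair_pmf (walk_pmf V adj (Suc l) a) (walk_pmf V adj (Suc l) b))) S =
    pair_avg V adj (\<lambda>x y. measure (measure_pmf (pair_pmf (walk_pmf V adj l x) (walk_pmf V adj l y)))
      {(xs, ys). (a # xs, b # ys) \<in> S}) a b"
  unfolding pair_walk_pmf_Suc measure_pair_uniform_bind[OF assms] pair_avg_def
  by (simp add: vimage_def case_prod_unfold)

lemma measure_avoid:
  assumes "\<And>v. v \<in> V \<Longrightarrow> finite (nbrs V adj v) \<and> nbrs V adj v \<noteq> {}" "a \<in> V" "b \<in> V"
  shows "measure (measure_pmf (pair_pmf (walk_pmf V adj m a) (walk_pmf V adj m b))) (noncoll 0 m)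
    = avoid V adj m a b"
  using assms(2,3)
proof (induction m arbitrary: a b)
  case 0
  show ?case
    by (auto simp: noncoll_def pair_return_pmf1 indicator_def)
next
  case (Suc m)
  have "{(xs, ys). (a # xs, b # ys) \<in> noncoll 0 (Suc m)} = (if a = b then {} else noncoll 0 m)"
    by (auto simp: noncoll_def nth_Cons' gr0_conv_Suc Suc_le_eq)
  then show ?case
    using Suc assms(1) by (subst measure_pair_walk_pmf_Suc)
      (auto simp: pair_avg_def nbrs_def intro!: sum.cong arg_cong2[where f = "(/)"])
qed

text \<open>Markov property at time \<open>n\<close>, one step at a time: each step leads to one of
  finitely many pairs in \<open>E\<close>, and the limit passes through finite averages. The set
  \<open>E\<close> is there because on a bipartite graph pairs at odd distance never meet and have
  to be excluded.\<close>

lemma measure_noncoll_tendsto_0: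
  assumes "\<And>v. v \<in> V \<Longrightarrow> finite (nbrs V adj v) \<and> nbrs V adj v \<noteq> {}" "(a, b) \<in> E"
    and E: "E \<subseteq> V \<times> V"
      "\<And>x y x' y'. (x, y) \<in> E \<Longrightarrow> x' \<in> nbrs V adj x \<Longrightarrow> y' \<in> nbrs V adj y \<Longrightarrow> (x', y') \<in> E"
    and lim: "\<And>x y. (x, y) \<in> E \<Longrightarrow> (\<lambda>m. avoid V adj m x y) \<longlonglongrightarrow> 0"
  shows "(\<lambda>m. measure (measure_pmf (pair_pmf (walk_pmf V adj (n + m) a) (walk_pmf V adj (n + m) b)))
    (noncoll n m)) \<longlonglongrightarrow> 0"
  using assms(2)
proof (induction n arbitrary: a b)
  case 0
  then show ?case
    using lim E(1) measure_avoid[OF assms(1)] by (auto simp: subset_iff)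
next
  case (Suc n)
  then have ab: "a \<in> V" "b \<in> V"
    using E by auto
  have *: "{(xs, ys). (a # xs, b # ys) \<in> noncoll (Suc n) m} = noncoll n m" for m
  proof -
    have "{Suc n..Suc n + m} = Suc ` {n..n + m}"
      by simp
    then show ?thesis
      by (simp add: noncoll_def del: image_Suc_atLeastAtMost)
  qed
  have eq: "measure (measure_pmf (pair_pmf (walk_pmf V adj (Suc n + m) a) (walk_pmf V adj (Suc n + m) b)))
    (noncoll (Suc n) m) = pair_avg V adj (\<lambda>x y. measure (measure_pmf (pair_pmf (walk_pmf V adj (n + m) x)
      (walk_pmf V adj (n + m) y))) (noncoll n m)) a b" for m
    using assms(1) ab by (simp only: add_Suc) (subst measure_pair_walk_pmf_Suc, auto simp: *)
  have "(\<lambda>m. pair_avg V adj (\<lambda>x y. measure (measure_pmf (pair_pmf (walk_pmf V adj (n + m) x)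
      (walk_pmf V adj (n + m) y))) (noncoll n m)) a b) \<longlonglongrightarrow> 
      (\<Sum>x'\<in>nbrs V adj a. \<Sum>y'\<in>nbrs V adj b. 0) / (real (card (nbrs V adj a)) * real (card (nbrs V adj b)))"
    unfolding pair_avg_def
    by (intro tendsto_divide tendsto_sum Suc.IH E(2)[OF Suc.prems] tendsto_const)
      (use assms(1) ab in auto)
  then show ?case
    unfolding eq by simp
qed

text \<open>Infinitely many collisions means one after every time \<open>n\<close>. For fixed
  \<open>n\<close>, absence of collisions from \<open>n\<close> on lies in all the finite-horizon
  events \<open>?N l\<close>, whose probabilities vanish as \<open>l\<close> grows.\<close>

lemma infinite_collision_propertyI:
  fixes V :: "'v::countable set"
  assumes "\<And>v. v \<in> V \<Longrightarrow> finite (nbrs V adj v) \<and> nbrs V adj v \<noteq> {}"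
    and E: "E \<subseteq> V \<times> V" "\<And>x. x \<in> V \<Longrightarrow> (x, x) \<in> E"
      "\<And>x y x' y'. (x, y) \<in> E \<Longrightarrow> x' \<in> nbrs V adj x \<Longrightarrow> y' \<in> nbrs V adj y \<Longrightarrow> (x', y') \<in> E"
    and lim: "\<And>x y. (x, y) \<in> E \<Longrightarrow> (\<lambda>m. avoid V adj m x y) \<longlonglongrightarrow> 0"
  shows "infinite_collision_property V adj"
  unfolding infinite_collision_property_def
proof
  fix a assume a: "a \<in> V"
  let ?S = "srw V adj a"
  interpret S: prob_space ?S by (rule prob_space_srw)
  interpret P: pair_prob_space ?S ?S ..
  have "AE z in ?S \<Otimes>\<^sub>M ?S. \<exists>t\<ge>n. fst z t = snd z t" for n
  proof -
    let ?N = "\<lambda>l. {z \<in> space (?S \<Otimes>\<^sub>M ?S). \<forall>t\<in>{n..n+l}. fst z t \<noteq> snd z t}"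
    have [measurable]: "(\<lambda>X. map X [0..<k]) \<in> ?S \<rightarrow>\<^sub>M count_space UNIV" for k
      using measurable_path_prefix[of k]
      by (subst measurable_cong_sets[OF srw_space_sets(2) refl])
    have eq: "P.prob (?N l) = measure (measure_pmf (pair_pmf (walk_pmf V adj (n + l) a)
        (walk_pmf V adj (n + l) a))) (noncoll n l)" and
      sets: "?N l \<in> sets (?S \<Otimes>\<^sub>M ?S)" for l
    proof -
      let ?f = "\<lambda>X :: nat \<Rightarrow> 'v. map X [0..<Suc (n + l)]"
      have cs: "count_space UNIV \<Otimes>\<^sub>M count_space UNIV = count_space (UNIV :: ('v list \<times> 'v list) set)"
        by (subst pair_measure_countable) auto
      have f: "(\<lambda>(x, y). (?f x, ?f y)) \<in> ?S \<Otimes>\<^sub>M ?S \<rightarrow>\<^sub>M count_space UNIV"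
        unfolding cs[symmetric] by measurable
      have N: "?N l = (\<lambda>(x, y). (?f x, ?f y)) -` noncoll n l \<inter> space (?S \<Otimes>\<^sub>M ?S)"
        by (auto simp: noncoll_def nth_append simp del: upt_Suc)
      show "?N l \<in> sets (?S \<Otimes>\<^sub>M ?S)"
        unfolding N by (rule measurable_sets[OF f]) auto
      have "distr (?S \<Otimes>\<^sub>M ?S) (count_space UNIV) (\<lambda>(x, y). (?f x, ?f y)) =
        distr ?S (count_space UNIV) ?f \<Otimes>\<^sub>M distr ?S (count_space UNIV) ?f"
        unfolding cs[symmetric]
        by (rule pair_measure_distr[symmetric])
          (auto intro!: prob_space_imp_sigma_finite S.prob_space_distr simp del: upt_Suc)
      also have "\<dots> = measure_pmf (walk_pmf V adj (n + l) a) \<Otimes>\<^sub>M measure_pmf (walk_pmf V adj (n + l) a)"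
        unfolding distr_srw_prefix ..
      also have "\<dots> = measure_pmf (pair_pmf (walk_pmf V adj (n + l) a) (walk_pmf V adj (n + l) a))"
      proof (rule measure_eqI_countable[where A = UNIV])
        fix z :: "'v list \<times> 'v list"
        obtain x y where z: "z = (x, y)" by force
        let ?W = "walk_pmf V adj (n + l) a"
        interpret W: pair_prob_space "measure_pmf ?W" "measure_pmf ?W" ..
        have "emeasure (measure_pmf ?W \<Otimes>\<^sub>M measure_pmf ?W) ({x} \<times> {y}) =
            emeasure (measure_pmf ?W) {x} * emeasure (measure_pmf ?W) {y}"
          by (intro measure_pmf.emeasure_pair_measure_Times) auto
        then show "emeasure (measure_pmf ?W \<Otimes>\<^sub>M measure_pmf ?W) {z} = emeasure (measure_pmf (pair_pmf ?W ?W)) {z}"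
          by (simp add: z emeasure_pmf_single pmf_pair ennreal_mult)
      qed (use sets_pair_measure_cong[OF sets_measure_pmf_count_space sets_measure_pmf_count_space,
          of "walk_pmf V adj (n + l) a" "walk_pmf V adj (n + l) a", unfolded cs] in simp_all)
      finally have d: "distr (?S \<Otimes>\<^sub>M ?S) (count_space UNIV) (\<lambda>(x, y). (?f x, ?f y)) =
        measure_pmf (pair_pmf (walk_pmf V adj (n + l) a) (walk_pmf V adj (n + l) a))" .
      show "P.prob (?N l) = measure (measure_pmf (pair_pmf (walk_pmf V adj (n + l) a)
        (walk_pmf V adj (n + l) a))) (noncoll n l)"
        unfolding d[symmetric] N by (subst measure_distr[OF f]) auto
    qed
    have lim0: "(\<lambda>l. P.prob (?N l)) \<longlonglongrightarrow> 0"
      unfolding eq using measure_noncoll_tendsto_0[OF assms(1) E(2)[OF a] E(1) E(3) lim] by auto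
    let ?I = "\<Inter>l. ?N l"
    have "P.prob ?I \<le> P.prob (?N l)" for l
      by (intro P.finite_measure_mono sets) auto
    then have "P.prob ?I \<le> 0"
      by (intro tendsto_lowerbound[OF lim0]) auto
    then have "P.prob ?I = 0"
      by (simp add: measure_le_0_iff)
    moreover have "?I \<in> P.events"
      using sets by auto
    ultimately have "AE z in ?S \<Otimes>\<^sub>M ?S. z \<notin> ?I"
      by (subst (asm) P.prob_eq_0) auto
    then show ?thesis
    proof (rule AE_mp, intro AE_I2 impI)
      fix z assume z: "z \<in> space (?S \<Otimes>\<^sub>M ?S)" "z \<notin> ?I"
      then show "\<exists>t\<ge>n. fst z t = snd z t"
        by auto
    qed
  qed
  then have "AE z in ?S \<Otimes>\<^sub>M ?S. \<forall>n. \<exists>t\<ge>n. fst z t = snd z t"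
    by (simp add: AE_all_countable)
  then show "AE (X, Y) in ?S \<Otimes>\<^sub>M ?S. infinite {t. X t = Y t}"
    by eventually_elim (auto simp: infinite_nat_iff_unbounded_le)
qed

section \<open>Collisions from subharmonic functions\<close>

lemma pair_avg_mono:
  assumes "\<And>x' y'. x' \<in> nbrs V adj x \<Longrightarrow> y' \<in> nbrs V adj y \<Longrightarrow> F x' y' \<le> G x' y'"
  shows "pair_avg V adj F x y \<le> pair_avg V adj G x y"
  unfolding pair_avg_def using assms by (intro divide_right_mono sum_mono) auto

lemma pair_avg_const:
  assumes "finite (nbrs V adj x) \<and> nbrs V adj x \<noteq> {}" "finite (nbrs V adj y) \<and> nbrs V adj y \<noteq> {}"
  shows "pair_avg V adj (\<lambda>_ _. c) x y = c"
  using assms by (simp add: pair_avg_def card_eq_0_iff field_simps)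

lemma pair_avg_linear:
  "pair_avg V adj (\<lambda>x y. F x y + G x y) x y = pair_avg V adj F x y + pair_avg V adj G x y"
  "pair_avg V adj (\<lambda>x y. c * F x y) x y = c * pair_avg V adj F x y"
  by (auto simp: pair_avg_def sum.distrib add_divide_distrib sum_distrib_left)

lemma tendsto_pair_avg:
  assumes "\<And>x' y'. x' \<in> nbrs V adj x \<Longrightarrow> y' \<in> nbrs V adj y \<Longrightarrow> (\<lambda>m. F m x' y') \<longlonglongrightarrow> G x' y'"
  shows "(\<lambda>m. pair_avg V adj (F m) x y) \<longlonglongrightarrow> pair_avg V adj G x y"
  unfolding pair_avg_def divide_inverse
  by (intro tendsto_mult tendsto_sum assms tendsto_const)

text \<open>The nonnegative differences \<open>F x' y' - c\<close> have a nonpositive sum, so each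
  vanishes: the strong minimum principle for one step.\<close>

lemma pair_avg_le_min_imp_eq:
  assumes fin: "finite (nbrs V adj x)" "finite (nbrs V adj y)"
    and le: "pair_avg V adj F x y \<le> c"
    and ge: "\<And>x' y'. x' \<in> nbrs V adj x \<Longrightarrow> y' \<in> nbrs V adj y \<Longrightarrow> c \<le> F x' y'"
    and xy: "x' \<in> nbrs V adj x" "y' \<in> nbrs V adj y"
  shows "F x' y' = c"
proof -
  let ?S = "nbrs V adj x \<times> nbrs V adj y"
  have pos: "real (card (nbrs V adj x)) * real (card (nbrs V adj y)) > 0"
    using fin xy by (intro mult_pos_pos) (auto simp: card_gt_0_iff)
  have "(\<Sum>(x', y')\<in>?S. F x' y' - c) = (\<Sum>x'\<in>nbrs V adj x. \<Sum>y'\<in>nbrs V adj y. F x' y') - real (card ?S) * c"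
    by (simp add: case_prod_unfold sum_subtractf sum.cartesian_product)
  also have "\<dots> \<le> 0"
    using le pos by (simp add: pair_avg_def card_cartesian_product divide_le_eq mult.commute)
  finally have "(\<Sum>(x', y')\<in>?S. F x' y' - c) = 0"
    using ge by (intro antisym sum_nonneg) auto
  then have "\<forall>z\<in>?S. (case z of (x', y') \<Rightarrow> F x' y' - c) = 0"
    using ge fin by (subst (asm) sum_nonneg_eq_0_iff) auto
  then show ?thesis
    using xy by auto
qed

text \<open>The function \<open>h\<close> below plays the role of the probability of a collision before leaving \<open>B\<close>.\<close>

lemma avoid_tendsto_0:
  fixes rnk :: "'v \<Rightarrow> 'v \<Rightarrow> int"
  assumes nb: "\<And>v. v \<in> V \<Longrightarrow> finite (nbrs V adj v) \<and> nbrs V adj v \<noteq> {}"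
    and E: "E \<subseteq> V \<times> V"
      "\<And>x y x' y'. (x, y) \<in> E \<Longrightarrow> x' \<in> nbrs V adj x \<Longrightarrow> y' \<in> nbrs V adj y \<Longrightarrow> (x', y') \<in> E"
    and rnk: "\<And>x y. (x, y) \<in> E \<Longrightarrow> \<exists>x'\<in>nbrs V adj x. \<exists>y'\<in>nbrs V adj y. rnk x y < rnk x' y'"
    and c: "c > 0"
    and h: "\<And>x y. (x, y) \<in> E \<Longrightarrow> \<exists>B h. finite B \<and> c \<le> h x y \<and>
      (\<forall>(x, y)\<in>E. h x y \<le> 1 \<and> ((x, y) \<notin> B \<longrightarrow> h x y \<le> 0) \<and>
         (x \<noteq> y \<longrightarrow> (x, y) \<in> B \<longrightarrow> h x y \<le> pair_avg V adj h x y))"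
    and xy: "(x, y) \<in> E"
  shows "(\<lambda>m. avoid V adj m x y) \<longlonglongrightarrow> 0"
proof -
  let ?a = "avoid V adj"
  have range: "0 \<le> ?a m x y \<and> ?a m x y \<le> 1" if "(x, y) \<in> E" for m x y
    using that
  proof (induction m arbitrary: x y)
    case (Suc m)
    have nb': "finite (nbrs V adj x) \<and> nbrs V adj x \<noteq> {}" "finite (nbrs V adj y) \<and> nbrs V adj y \<noteq> {}"
      using nb Suc.prems E(1) by auto
    have "pair_avg V adj (\<lambda>_ _. 0) x y \<le> pair_avg V adj (?a m) x y"
      "pair_avg V adj (?a m) x y \<le> pair_avg V adj (\<lambda>_ _. 1) x y"
      using Suc.IH E(2)[OF Suc.prems] by (auto intro!: pair_avg_mono)
    then show ?case
      using nb' by (simp add: pair_avg_const)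
  qed simp
  have dec: "?a (Suc m) x y \<le> ?a m x y" if "(x, y) \<in> E" for m x y
    using that
  proof (induction m arbitrary: x y)
    case 0
    show ?case
      using range[OF 0, of "Suc 0"] by (auto split: if_splits)
  next
    case (Suc m)
    then show ?case
      using E(2)[OF Suc.prems] by (auto simp del: avoid.simps simp: avoid.simps(2) intro!: pair_avg_mono)
  qed
  \<comment> \<open>The probability of never meeting; it vanishes on the diagonal and is harmonic
    off it.\<close>
  define w where "w x y = lim (\<lambda>m. ?a m x y)" for x y
  have w: "(\<lambda>m. ?a m x y) \<longlonglongrightarrow> w x y" if "(x, y) \<in> E" for x y
  proof -
    have "decseq (\<lambda>m. ?a m x y)"
      using dec[OF that] by (intro decseq_SucI)
    then have "convergent (\<lambda>m. ?a m x y)"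
      using decseq_convergent[of "\<lambda>m. ?a m x y" 0] range[OF that] by (metis convergentI)
    then show ?thesis
      by (simp add: w_def convergent_LIMSEQ_iff)
  qed
  have w_range: "0 \<le> w x y \<and> w x y \<le> 1" if "(x, y) \<in> E" for x y
    using LIMSEQ_le_const[OF w[OF that], of 0] LIMSEQ_le_const2[OF w[OF that], of 1] range[OF that] by simp
  have w_diag: "w x x = 0" if "(x, x) \<in> E" for x
  proof -
    have "?a m x x = 0" for m
      by (cases m) auto
    then show ?thesis
      using w[OF that] by (simp add: LIMSEQ_const_iff)
  qed
  have w_avg: "w x y = pair_avg V adj w x y" if "(x, y) \<in> E" "x \<noteq> y" for x y
  proof (rule LIMSEQ_unique)
    show "(\<lambda>m. ?a (Suc m) x y) \<longlonglongrightarrow> w x y"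
      using w[OF that(1)] by (rule LIMSEQ_Suc)
    show "(\<lambda>m. ?a (Suc m) x y) \<longlonglongrightarrow> pair_avg V adj w x y"
      using that by (auto intro!: tendsto_pair_avg w E(2)[OF that(1)])
  qed
  have w_bound: "w x y \<le> 1 - c" if xy: "(x, y) \<in> E" "x \<noteq> y" for x y
  proof -
    from h[OF xy(1)] obtain B h where B: "finite B" and hc: "c \<le> h x y"
      and H: "\<forall>(x, y)\<in>E. h x y \<le> 1 \<and> ((x, y) \<notin> B \<longrightarrow> h x y \<le> 0) \<and>
         (x \<noteq> y \<longrightarrow> (x, y) \<in> B \<longrightarrow> h x y \<le> pair_avg V adj h x y)"
      by (elim exE conjE)
    have h1: "h x y \<le> 1" and h0: "(x, y) \<notin> B \<Longrightarrow> h x y \<le> 0"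
      and havg: "x \<noteq> y \<Longrightarrow> (x, y) \<in> B \<Longrightarrow> h x y \<le> pair_avg V adj h x y" if "(x, y) \<in> E" for x y
      using bspec[OF H that] by simp_all
    \<comment> \<open>\<open>u\<close> is superharmonic on the finite set \<open>B'\<close> and
      nonnegative on the rest of \<open>E\<close>. The minimum principle will give
      \<open>u \<ge> 0\<close>, that is \<open>w \<le> 1 - h\<close>.\<close>
    define u where "u x y = 1 - h x y - w x y" for x y
    define B' where "B' = {(x, y) \<in> E \<inter> B. x \<noteq> y}"
    have u_out: "u x y \<ge> 0" if "(x, y) \<in> E" "(x, y) \<notin> B'" for x y
      using that h1[of x y] h0[of x y] w_range[of x y] w_diag[of x] by (auto simp: u_def B'_def)
    have u_avg: "pair_avg V adj u x y \<le> u x y" if "(x, y) \<in> B'" for x y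
    proof -
      have xy: "(x, y) \<in> E" "x \<noteq> y" "(x, y) \<in> B"
        using that by (auto simp: B'_def)
      have nb': "finite (nbrs V adj x) \<and> nbrs V adj x \<noteq> {}" "finite (nbrs V adj y) \<and> nbrs V adj y \<noteq> {}"
        using nb xy(1) E(1) by auto
      have "u = (\<lambda>x y. 1 + ((-1) * h x y + (-1) * w x y))"
        by (auto simp: u_def fun_eq_iff)
      then have "pair_avg V adj u x y = 1 + ((- 1) * pair_avg V adj h x y + (- 1) * pair_avg V adj w x y)"
        by (simp only: pair_avg_linear pair_avg_const[OF nb'])
      then show ?thesis
        using havg[OF xy] w_avg[OF xy(1,2)] by (simp add: u_def)
    qed
    have "u x y \<ge> 0"
    proof (rule ccontr)
      assume neg: "\<not> u x y \<ge> 0"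
      have fin: "finite B'"
        using B by (auto simp: B'_def intro: finite_subset[of _ B])
      have ne: "(x, y) \<in> B'"
        using neg u_out[OF xy(1)] by auto
      define c0 where "c0 = Min ((\<lambda>(x, y). u x y) ` B')"
      have c0_le: "c0 \<le> u x y" if "(x, y) \<in> B'" for x y
        unfolding c0_def using fin that by (intro Min_le) auto
      have c0_neg: "c0 < 0"
        using c0_le[OF ne] neg by simp
      \<comment> \<open>Take a minimising pair of largest rank. All its neighbouring pairs are
        minimisers too, and by \<open>rnk\<close> one of them has larger rank; this rules out a
        negative minimum.\<close>
      define A where "A = {(x, y) \<in> B'. u x y = c0}"
      have "c0 \<in> (\<lambda>(x, y). u x y) ` B'"
        unfolding c0_def using fin ne by (intro Min_in) auto
      then have "A \<noteq> {}"
        by (auto simp: A_def)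
      moreover have "finite A"
        using fin by (auto simp: A_def intro: finite_subset[of _ B'])
      ultimately have "Max ((\<lambda>(x, y). rnk x y) ` A) \<in> (\<lambda>(x, y). rnk x y) ` A"
        by (intro Max_in) auto
      then obtain a b where ab: "(a, b) \<in> A" "Max ((\<lambda>(x, y). rnk x y) ` A) = rnk a b"
        by auto
      have rnk_le: "rnk x y \<le> rnk a b" if "(x, y) \<in> A" for x y
        unfolding ab(2)[symmetric] using \<open>finite A\<close> that by (intro Max_ge) force+
      have abE: "(a, b) \<in> E" "(a, b) \<in> B'" "u a b = c0"
        using ab(1) by (auto simp: A_def B'_def)
      have ge: "c0 \<le> u x' y'" if "x' \<in> nbrs V adj a" "y' \<in> nbrs V adj b" for x' y'
        using E(2)[OF abE(1) that] u_out[of x' y'] c0_le[of x' y'] c0_neg by (cases "(x', y') \<in> B'") auto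
      obtain a' b' where ab': "a' \<in> nbrs V adj a" "b' \<in> nbrs V adj b" "rnk a b < rnk a' b'"
        using rnk[OF abE(1)] by blast
      have "u a' b' = c0"
        using nb abE(1) E(1) u_avg[OF abE(2)] abE(3) ge ab'
        by (intro pair_avg_le_min_imp_eq[of V adj a b u c0]) auto
      moreover have "(a', b') \<in> B'"
        using u_out[OF E(2)[OF abE(1) ab'(1,2)]] calculation c0_neg by linarith
      ultimately have "(a', b') \<in> A"
        by (simp add: A_def)
      then show False
        using rnk_le[of a' b'] ab'(3) by simp
    qed
    then show ?thesis
      using hc by (simp add: u_def)
  qed
  \<comment> \<open>The bound \<open>1 - c\<close> improves itself: \<open>w\<close> is harmonic off
    the diagonal, so averaging carries the bound through the recursion of \<open>avoid\<close>. In
    the limit \<open>w \<le> (1 - c) * w\<close>, which forces \<open>w = 0\<close>.\<close>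
  have le: "w x y \<le> (1 - c) * ?a m x y" if "(x, y) \<in> E" for m x y
    using that
  proof (induction m arbitrary: x y)
    case 0
    then show ?case
      using w_bound w_diag by auto
  next
    case (Suc m)
    show ?case
    proof (cases "x = y")
      case False
      have "w x y = pair_avg V adj w x y"
        by (rule w_avg[OF Suc.prems False])
      also have "\<dots> \<le> pair_avg V adj (\<lambda>x y. (1 - c) * ?a m x y) x y"
        by (intro pair_avg_mono Suc.IH E(2)[OF Suc.prems])
      also have "\<dots> = (1 - c) * ?a (Suc m) x y"
        using False by (simp add: pair_avg_linear)
      finally show ?thesis .
    qed (use w_diag Suc.prems in auto)
  qed
  have "(\<lambda>m. (1 - c) * ?a m x y) \<longlonglongrightarrow> (1 - c) * w x y"
    by (intro tendsto_mult w xy tendsto_const)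
  then have "w x y \<le> (1 - c) * w x y"
    by (rule LIMSEQ_le_const) (use le[OF xy] in blast)
  then have "c * w x y \<le> 0"
    by (simp add: algebra_simps)
  then have "w x y = 0"
    using c w_range[OF xy] by (simp add: mult_le_0_iff)
  then show ?thesis
    using w[OF xy] by simp
qed

section \<open>Trees with a distinguished end\<close>

text \<open>\<open>par x\<close> is the neighbour of \<open>x\<close> towards the end; \<open>lvl\<close> is a Busemann function.\<close>

locale ended_tree =
  fixes V :: "'v set" and adj :: "'v \<Rightarrow> 'v \<Rightarrow> bool" and par :: "'v \<Rightarrow> 'v" and lvl :: "'v \<Rightarrow> int"
  assumes par_in: "x \<in> V \<Longrightarrow> par x \<in> V"
    and lvl_par: "x \<in> V \<Longrightarrow> lvl (par x) = lvl x + 1"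
    and nbrs_eq: "x \<in> V \<Longrightarrow> nbrs V adj x = insert (par x) {z \<in> V. par z = x}"
    and finite_nbrs: "x \<in> V \<Longrightarrow> finite (nbrs V adj x)"
begin

definition orb :: "'v \<Rightarrow> 'v set" where
  "orb x = range (\<lambda>k. (par ^^ k) x)"

lemma funpow_par_in: "x \<in> V \<Longrightarrow> (par ^^ k) x \<in> V"
  by (induction k) (auto intro: par_in)

lemma lvl_funpow_par: "x \<in> V \<Longrightarrow> lvl ((par ^^ k) x) = lvl x + int k"
  by (induction k) (auto simp: lvl_par funpow_par_in)

lemma orb_self: "x \<in> orb x"
  unfolding orb_def by (rule range_eqI[of _ _ 0]) simp

lemma orb_unfold: "orb x = insert x (orb (par x))"
proof -
  have "(par ^^ k) x \<in> insert x (range (\<lambda>k. (par ^^ k) (par x)))" for k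
    by (cases k) (auto simp: funpow_swap1)
  moreover have "(par ^^ k) (par x) \<in> range (\<lambda>k. (par ^^ k) x)" for k
    by (rule range_eqI[of _ _ "Suc k"]) (simp add: funpow_swap1)
  ultimately show ?thesis
    using orb_self[of x] by (auto simp: orb_def)
qed

lemma orb_par_subset: "orb (par x) \<subseteq> orb x"
  using orb_unfold by blast

lemma orb_trans: "y \<in> orb x \<Longrightarrow> orb y \<subseteq> orb x"
proof -
  assume "y \<in> orb x"
  then obtain k where k: "y = (par ^^ k) x"
    by (auto simp: orb_def)
  have "(par ^^ j) ((par ^^ k) x) = (par ^^ (j + k)) x" for j
    by (simp add: funpow_add)
  then show ?thesis
    by (auto simp: orb_def k)
qed

lemma orb_lvl:
  assumes "x \<in> V" "y \<in> orb x"
  shows "y \<in> V" "lvl x \<le> lvl y" "y = (par ^^ nat (lvl y - lvl x)) x"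
  using assms by (auto simp: orb_def lvl_funpow_par funpow_par_in)

lemma orb_inj: "x \<in> V \<Longrightarrow> y \<in> orb x \<Longrightarrow> z \<in> orb x \<Longrightarrow> lvl y = lvl z \<Longrightarrow> y = z"
  using orb_lvl(3) by metis

lemma not_in_orb_par: "x \<in> V \<Longrightarrow> x \<notin> orb (par x)"
  using orb_lvl(2)[of "par x" x] lvl_par[of x] par_in[of x] by auto

section \<open>The Green kernel of a finite set closed under descendants\<close>

definition green :: "'v set \<Rightarrow> 'v \<Rightarrow> 'v \<Rightarrow> real" where
  "green B x y = real (card (orb x \<inter> orb y \<inter> B))"

lemma green_commute: "green B x y = green B y x"
  by (simp add: green_def Int_commute)

text \<open>The two rays merge strictly above both \<open>x\<close> and \<open>y\<close>, and a step
  of either walk alters its own ray only below that point.\<close>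

lemma orb_Int_nbrs_incomparable:
  assumes V: "x \<in> V" "y \<in> V" and ne: "x \<notin> orb y" "y \<notin> orb x"
    and x': "x' \<in> nbrs V adj x" and y': "y' \<in> nbrs V adj y"
  shows "orb x' \<inter> orb y' = orb x \<inter> orb y"
proof -
  have *: "orb x' \<inter> orb y \<subseteq> orb x \<inter> orb y \<and> orb x - {x} \<subseteq> orb x'"
    if V: "x \<in> V" "y \<in> V" and ne: "x \<notin> orb y" and x': "x' \<in> nbrs V adj x" for x y x'
  proof (cases "x' = par x")
    case True
    then show ?thesis
      using orb_unfold[of x] by auto
  next
    case False
    then have p: "par x' = x" "x' \<in> V"
      using nbrs_eq[OF V(1)] x' by auto
    have "x' \<notin> orb y"
      using ne orb_trans[of x' y] orb_unfold[of x'] p orb_self[of x] by auto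
    then show ?thesis
      using orb_unfold[of x'] p by auto
  qed
  have y'V: "y' \<in> V" and x'V: "x' \<in> V"
    using x' y' by (auto simp: nbrs_def)
  \<comment> \<open>Both coordinates move at once, so \<open>x\<close> has to stay off the ray of
    the second vertex after \<open>y\<close> has moved; only then does \<open>*\<close> apply to the
    move of \<open>x\<close>.\<close>
  have xy': "x \<notin> orb y'"
  proof
    assume a: "x \<in> orb y'"
    show False
    proof (cases "y' = par y")
      case True
      then show ?thesis
        using a ne orb_par_subset by auto
    next
      case False
      then have "par y' = y"
        using nbrs_eq[OF V(2)] y' by auto
      then have "x = y' \<or> x \<in> orb y"
        using a orb_unfold[of y'] by auto
      then show ?thesis
        using ne \<open>par y' = y\<close> orb_unfold[of x] orb_self by auto
    qed
  qed
  have "orb x' \<inter> orb y' \<subseteq> orb x \<inter> orb y'"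
    using *[OF V(1) y'V xy' x'] by blast
  moreover have "orb y' \<inter> orb x \<subseteq> orb y \<inter> orb x"
    using *[OF V(2,1) ne(2) y'] by blast
  moreover have "orb x \<inter> orb y \<subseteq> orb x' \<inter> orb y'"
    using *[OF V ne(1) x'] *[OF V(2,1) ne(2) y'] ne by blast
  ultimately show ?thesis
    by blast
qed

text \<open>Moving \<open>x\<close> to its parent drops \<open>x\<close> from the common ray, moving
  it to the child \<open>z\<close> on the way to \<open>y\<close> adds \<open>z\<close>, and the
  other children change nothing: the contributions -1 and +1 cancel.\<close>

lemma sum_green_nbrs_above:
  assumes V: "x \<in> V" "y \<in> V" and xy: "x \<in> orb y" "x \<noteq> y" and par: "even (lvl x + lvl y)"
    and B: "finite B" "x \<in> B" "\<And>z. z \<in> V \<Longrightarrow> par z \<in> B \<Longrightarrow> z \<in> B"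
    and y': "y' \<in> nbrs V adj y"
  shows "(\<Sum>x'\<in>nbrs V adj x. green B x' y') = real (card (nbrs V adj x)) * green B x y"
proof -
  have y'V: "y' \<in> V"
    using y' by (auto simp: nbrs_def)
  have x_eq: "x = (par ^^ nat (lvl x - lvl y)) y" and le: "lvl y \<le> lvl x"
    using orb_lvl[OF V(2) xy(1)] by auto
  have "lvl x \<noteq> lvl y"
    using orb_inj[OF V(2) xy(1) orb_self] xy(2) by auto
  \<comment> \<open>Equal parity rules out a gap of 1. Hence \<open>z\<close> differs from
    \<open>y\<close> and stays on the ray of \<open>y'\<close> even if
    \<open>y' = par y\<close>.\<close>
  then have lt: "lvl x \<ge> lvl y + 2"
    using le par by presburger
  define k where "k = nat (lvl x - lvl y) - 1"
  have k: "nat (lvl x - lvl y) = Suc k" "k > 0"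
    using lt by (auto simp: k_def)
  define z where "z = (par ^^ k) y"
  have zV: "z \<in> V"
    by (simp add: z_def funpow_par_in V)
  have zx: "par z = x"
    using x_eq k by (simp add: z_def)
  have zy: "z \<in> orb y"
    by (auto simp: z_def orb_def)
  have z_ne: "z \<noteq> y"
    using lvl_par[OF zV] zx lt by auto
  have zy': "z \<in> orb y'"
  proof (cases "y' = par y")
    case True
    then show ?thesis
      using zy z_ne orb_unfold[of y] by auto
  next
    case False
    then have "par y' = y"
      using nbrs_eq[OF V(2)] y' by auto
    then show ?thesis
      using zy orb_unfold[of y'] by auto
  qed
  have orbz: "orb z = insert z (orb x)"
    using orb_unfold[of z] zx by simp
  have orbzy: "orb z \<subseteq> orb y'"
    by (rule orb_trans[OF zy'])
  have zB: "z \<in> B"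
    using B(3)[OF zV] zx B(2) by simp
  have z_notin: "z \<notin> orb x"
    using not_in_orb_par[OF zV] zx by simp
  have gxy: "green B x y = real (card (orb x \<inter> B))"
    using orb_trans[OF xy(1)] by (auto simp: green_def Int_absorb2)
  have g_par: "green B (par x) y' = green B x y - 1"
  proof -
    have "orb (par x) \<inter> orb y' \<inter> B = (orb x \<inter> B) - {x}"
      using orb_unfold[of x] not_in_orb_par[OF V(1)] orbz orbzy by auto
    moreover have "x \<in> orb x \<inter> B"
      using orb_self B by auto
    moreover from this have "card (orb x \<inter> B) > 0"
      using B(1) by (auto simp: card_gt_0_iff)
    ultimately show ?thesis
      unfolding gxy using B(1) by (simp add: green_def card_Diff_singleton of_nat_diff)
  qed
  have g_z: "green B z y' = green B x y + 1"
  proof -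
    have "orb z \<inter> orb y' \<inter> B = insert z (orb x \<inter> B)"
      using orbz orbzy zB by auto
    then show ?thesis
      unfolding gxy using B(1) z_notin by (simp add: green_def)
  qed
  have g_other: "green B x' y' = green B x y" if "x' \<in> nbrs V adj x - {par x, z}" for x'
  proof -
    have x': "x' \<in> V" "par x' = x"
      using that nbrs_eq[OF V(1)] by auto
    have "lvl x' = lvl z"
      using lvl_par[OF x'(1)] lvl_par[OF zV] x' zx by simp
    then have "x' \<notin> orb y'"
      using orb_inj[OF y'V zy', of x'] that by auto
    then have "orb x' \<inter> orb y' \<inter> B = orb x \<inter> B"
      using orb_unfold[of x'] x' orbz orbzy by auto
    then show ?thesis
      unfolding gxy by (simp add: green_def)
  qed
  have ne: "par x \<noteq> z"
    using lvl_par[OF zV] lvl_par[OF V(1)] zx by auto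
  have sub: "{par x, z} \<subseteq> nbrs V adj x"
    using nbrs_eq[OF V(1)] zV zx by auto
  have fin: "finite (nbrs V adj x)"
    by (rule finite_nbrs[OF V(1)])
  have "(\<Sum>x'\<in>nbrs V adj x. green B x' y') =
      (\<Sum>x'\<in>nbrs V adj x - {par x, z}. green B x' y') + (\<Sum>x'\<in>{par x, z}. green B x' y')"
    by (rule sum.subset_diff[OF sub fin])
  also have "\<dots> = (\<Sum>x'\<in>nbrs V adj x - {par x, z}. green B x y) + (\<Sum>x'\<in>{par x, z}. green B x y)"
    using ne g_other g_par g_z by simp
  also have "\<dots> = (\<Sum>x'\<in>nbrs V adj x. green B x y)"
    by (rule sum.subset_diff[OF sub fin, symmetric])
  finally show ?thesis
    by simp
qed

text \<open>If one vertex lies on the ray of the other, sum first over the neighbours of the upper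
  one; if neither does, the common part of the rays is the same for all neighbouring pairs.\<close>

lemma green_harmonic:
  assumes V: "x \<in> V" "y \<in> V" and "x \<noteq> y" and par: "even (lvl x + lvl y)"
    and B: "finite B" "x \<in> B" "y \<in> B" "\<And>z. z \<in> V \<Longrightarrow> par z \<in> B \<Longrightarrow> z \<in> B"
  shows "pair_avg V adj (green B) x y = green B x y"
proof -
  have pos: "card (nbrs V adj x) > 0" "card (nbrs V adj y) > 0"
    using finite_nbrs V nbrs_eq by (auto simp: card_gt_0_iff)
  have "(\<Sum>x'\<in>nbrs V adj x. \<Sum>y'\<in>nbrs V adj y. green B x' y') =
     real (card (nbrs V adj x)) * real (card (nbrs V adj y)) * green B x y"
  proof -
    consider "x \<in> orb y" | "y \<in> orb x" | "x \<notin> orb y" "y \<notin> orb x"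
      by blast
    then show ?thesis
    proof cases
      case 1
      show ?thesis
        using sum_green_nbrs_above[OF V 1 assms(3) par B(1,2,4)]
        by (subst sum.swap) simp
    next
      case 2
      have "(\<Sum>y'\<in>nbrs V adj y. green B x' y') = real (card (nbrs V adj y)) * green B x y"
        if "x' \<in> nbrs V adj x" for x'
        using sum_green_nbrs_above[OF V(2,1) 2 assms(3)[symmetric] _ B(1,3,4) that] par
        by (simp add: green_commute add.commute)
      then show ?thesis
        by simp
    next
      case 3
      have "green B x' y' = green B x y" if "x' \<in> nbrs V adj x" "y' \<in> nbrs V adj y" for x' y'
        using orb_Int_nbrs_incomparable[OF V 3 that] by (simp add: green_def)
      then show ?thesis
        by simp
    qed
  qed
  then show ?thesis
    using pos by (simp add: pair_avg_def)
qed

text \<open>The kernel divided by \<open>M\<close>, a bound for its diagonal, is a lower bound for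
  the chance of meeting inside \<open>B\<close>.\<close>

lemma avoid_tendsto_0_if_green:
  assumes c: "c > 0"
    and B: "\<And>x y. x \<in> V \<Longrightarrow> y \<in> V \<Longrightarrow> \<exists>B M. finite B \<and> B \<subseteq> V \<and> (\<forall>z\<in>V. par z \<in> B \<longrightarrow> z \<in> B) \<and>
        M > 0 \<and> (\<forall>z\<in>V. real (card (orb z \<inter> B)) \<le> M) \<and> c * M \<le> green B x y"
    and xy: "x \<in> V" "y \<in> V" "even (lvl x + lvl y)"
  shows "(\<lambda>m. avoid V adj m x y) \<longlonglongrightarrow> 0"
proof -
  let ?E = "{(x, y). x \<in> V \<and> y \<in> V \<and> even (lvl x + lvl y)}"
  have lvl_nb: "x' \<in> V \<and> (lvl x' = lvl x + 1 \<or> lvl x' = lvl x - 1)"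
    if "x \<in> V" "x' \<in> nbrs V adj x" for x x'
    using that nbrs_eq[OF that(1)] lvl_par par_in by fastforce
  show "(\<lambda>m. avoid V adj m x y) \<longlonglongrightarrow> 0"
  \<comment> \<open>Each step changes a level by 1, so joint moves preserve \<open>?E\<close>. The
    level of the first walk serves as rank because a step to its parent is always possible.\<close>
  proof (rule avoid_tendsto_0[where E = ?E and rnk = "\<lambda>x y. lvl x" and c = c])
    show "finite (nbrs V adj v) \<and> nbrs V adj v \<noteq> {}" if "v \<in> V" for v
      using finite_nbrs[OF that] nbrs_eq[OF that] by simp
    show "?E \<subseteq> V \<times> V"
      by auto
    show "(x', y') \<in> ?E" if "(x, y) \<in> ?E" "x' \<in> nbrs V adj x" "y' \<in> nbrs V adj y" for x y x' y'
      using that lvl_nb[of x x'] lvl_nb[of y y'] by auto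
    show "\<exists>x'\<in>nbrs V adj x. \<exists>y'\<in>nbrs V adj y. lvl x < lvl x'" if "(x, y) \<in> ?E" for x y
      using that nbrs_eq[of x] nbrs_eq[of y] lvl_par[of x] by auto
    show "(x, y) \<in> ?E"
      using xy by simp
    show "c > 0" by fact
    fix x y assume "(x, y) \<in> ?E"
    then have xy: "x \<in> V" "y \<in> V" "even (lvl x + lvl y)"
      by auto
    obtain B M where BM: "finite B" "B \<subseteq> V" "\<And>z. z \<in> V \<Longrightarrow> par z \<in> B \<Longrightarrow> z \<in> B" "M > 0"
      "\<And>z. z \<in> V \<Longrightarrow> real (card (orb z \<inter> B)) \<le> M" "c * M \<le> green B x y"
      using B[OF xy(1,2)] by metis
    \<comment> \<open>Closure of \<open>B\<close> under descendants says that its complement is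
      closed under \<open>par\<close>: a ray that starts outside never enters.\<close>
    have orb_out: "orb z \<inter> B = {}" if "z \<in> V" "z \<notin> B" for z
    proof -
      have "(par ^^ k) z \<notin> B" for k
        by (induction k) (use that BM(3) funpow_par_in in auto)
      then show ?thesis
        by (auto simp: orb_def)
    qed
    show "\<exists>B h. finite B \<and> c \<le> h x y \<and>
      (\<forall>(x, y)\<in>?E. h x y \<le> 1 \<and> ((x, y) \<notin> B \<longrightarrow> h x y \<le> 0) \<and>
         (x \<noteq> y \<longrightarrow> (x, y) \<in> B \<longrightarrow> h x y \<le> pair_avg V adj h x y))"
    proof (intro exI conjI ballI)
      show "finite (B \<times> B)"
        using BM by simp
      show "c \<le> (1 / M) * green B x y"
        using BM by (simp add: field_simps)
      fix p assume "p \<in> ?E"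
      then obtain x y where p: "p = (x, y)" and xy: "x \<in> V" "y \<in> V" "even (lvl x + lvl y)"
        by auto
      have "green B x y \<le> real (card (orb x \<inter> B))"
        using BM(1) by (auto simp: green_def intro!: card_mono)
      then have 1: "green B x y \<le> M"
        using BM(5)[OF xy(1)] by simp
      have 2: "green B x y = 0" if "x \<notin> B \<or> y \<notin> B"
      proof -
        have "orb x \<inter> orb y \<inter> B = {}"
          using orb_out[OF xy(1)] orb_out[OF xy(2)] that by blast
        then show ?thesis
          by (simp add: green_def)
      qed
      show "case p of (x, y) \<Rightarrow> 1 / M * green B x y \<le> 1 \<and> ((x, y) \<notin> B \<times> B \<longrightarrow> 1 / M * green B x y \<le> 0) \<and>
         (x \<noteq> y \<longrightarrow> (x, y) \<in> B \<times> B \<longrightarrow> 1 / M * green B x y \<le> pair_avg V adj (\<lambda>x y. 1 / M * green B x y) x y)"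
        unfolding p prod.case pair_avg_linear
      proof (intro conjI impI)
        show "1 / M * green B x y \<le> 1"
          using 1 BM(4) by simp
        show "1 / M * green B x y \<le> 0" if "(x, y) \<notin> B \<times> B"
          using 2 that by auto
        show "1 / M * green B x y \<le> 1 / M * pair_avg V adj (green B) x y" if "x \<noteq> y" "(x, y) \<in> B \<times> B"
          using green_harmonic[OF xy(1,2) that(1) xy(3) BM(1) _ _ BM(3)] that(2) by simp
      qed
    qed
  qed
qed

end

section \<open>The surviving tree\<close>

lemma uh_tree_snoc: "u @ [k] \<in> uh_tree c \<longleftrightarrow> u \<in> uh_tree c \<and> k < c u"
  by (auto intro: uh_tree.child elim: uh_tree.cases)

text \<open>Trades the inductive definition for a condition on finitely many values of
  \<open>c\<close>, which makes tree events measurable and lets trees be compared label by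
  label.\<close>

lemma uh_tree_iff: "x \<in> uh_tree c \<longleftrightarrow> (\<forall>i<length x. x ! i < c (take i x))"
proof (induction x rule: rev_induct)
  case (snoc k x)
  then show ?case
    by (auto simp: uh_tree_snoc nth_append less_Suc_eq)
qed (auto intro: uh_tree.root)

lemma finite_uh_tree_length_le: "finite {x \<in> uh_tree c. length x \<le> m}"
proof (induction m)
  case (Suc m)
  have "{x \<in> uh_tree c. length x \<le> Suc m} \<subseteq>
     insert [] (\<Union>x\<in>{x \<in> uh_tree c. length x \<le> m}. (\<lambda>k. x @ [k]) ` {..<c x})"
  proof
    fix x assume "x \<in> {x \<in> uh_tree c. length x \<le> Suc m}"
    then show "x \<in> insert [] (\<Union>x\<in>{x \<in> uh_tree c. length x \<le> m}. (\<lambda>k. x @ [k]) ` {..<c x})"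
      by (cases x rule: rev_cases) (auto simp: uh_tree_snoc)
  qed
  then show ?case
    by (rule finite_subset) (use Suc in auto)
qed simp

lemma length_spine [simp]: "length (spine \<sigma> n) = n"
  by (simp add: spine_def)

lemma spine_Suc: "spine \<sigma> (Suc n) = spine \<sigma> n @ [snd (\<sigma> n)]"
  by (simp add: spine_def)

lemma take_spine: "m \<le> n \<Longrightarrow> take m (spine \<sigma> n) = spine \<sigma> m"
  by (simp add: spine_def take_map)

section \<open>The surviving tree, directed towards the end of its spine\<close>

locale spine_tree =
  fixes \<sigma> :: "nat \<Rightarrow> nat \<times> nat" and \<omega> :: "nat list \<Rightarrow> nat"
  assumes spine_valid: "snd (\<sigma> n) < fst (\<sigma> n)"
begin

abbreviation "s \<equiv> spine \<sigma>"

abbreviation "V \<equiv> surviving_tree (\<sigma>, \<omega>)"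

definition offspring :: "nat list \<Rightarrow> nat" where
  "offspring u = (if u = s (length u) then fst (\<sigma> (length u)) else \<omega> u)"

lemma V_eq: "V = uh_tree offspring"
  by (simp add: surviving_tree_def offspring_def[abs_def])

lemma spine_in_V: "s n \<in> V"
  unfolding V_eq
proof (induction n)
  case 0
  then show ?case
    by (simp add: spine_def uh_tree.root)
next
  case (Suc n)
  then show ?case
    by (simp add: spine_Suc uh_tree_snoc offspring_def spine_valid)
qed

text \<open>Towards the end means away from the root on the spine and back towards the root
  elsewhere.\<close>

definition par :: "nat list \<Rightarrow> nat list" where
  "par x = (if x = s (length x) then s (Suc (length x)) else butlast x)"

text \<open>A path from the root never returns to the spine after leaving it, so this is the index
  of the spine vertex where \<open>x\<close> branches off, minus the distance of \<open>x\<close>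
  from that vertex.\<close>

definition lvl :: "nat list \<Rightarrow> int" where
  "lvl x = (\<Sum>i<length x. if take (Suc i) x = s (Suc i) then 1 else - 1)"

lemma lvl_snoc: "lvl (x @ [k]) = lvl x + (if x @ [k] = s (Suc (length x)) then 1 else - 1)"
  by (simp add: lvl_def)

lemma off_spine_snoc:
  assumes "x \<noteq> s (length x)"
  obtains u k where "x = u @ [k]" "par x = u"
  using assms by (cases x rule: rev_cases) (auto simp: par_def spine_def)

lemma V_par: "x \<in> V \<Longrightarrow> par x \<in> V"
proof (cases "x = s (length x)")
  case True
  then show ?thesis
    by (auto simp: par_def spine_in_V)
next
  case False
  then obtain u k where "x = u @ [k]" "par x = u"
    by (rule off_spine_snoc)
  then show "x \<in> V \<Longrightarrow> ?thesis"
    by (simp add: V_eq uh_tree_snoc)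
qed

lemma lvl_par_eq: "lvl (par x) = lvl x + 1"
proof (cases "x = s (length x)")
  case True
  then have "par x = x @ [snd (\<sigma> (length x))]" "par x = s (Suc (length x))"
    by (auto simp: par_def spine_Suc)
  then show ?thesis
    by (metis lvl_snoc)
next
  case False
  then obtain u k where "x = u @ [k]" "par x = u"
    by (rule off_spine_snoc)
  then show ?thesis
    using False by (simp add: lvl_snoc)
qed

text \<open>Every edge joins some \<open>u\<close> to \<open>u @ [k]\<close>. It points to
  \<open>u @ [k]\<close> if that vertex is on the spine and to \<open>u\<close> otherwise, so it
  comes from \<open>par\<close> at exactly one end.\<close>

lemma nbrs_par:
  assumes "x \<in> V"
  shows "nbrs V uh_adj x = insert (par x) {z \<in> V. par z = x}"
proof (intro equalityI subsetI)
  fix z assume z: "z \<in> nbrs V uh_adj x"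
  then have zV: "z \<in> V"
    by (simp add: nbrs_def)
  from z obtain k where "z = x @ [k] \<or> x = z @ [k]"
    by (auto simp: nbrs_def uh_adj_def)
  then show "z \<in> insert (par x) {z \<in> V. par z = x}"
  proof
    assume z: "z = x @ [k]"
    show ?thesis
    proof (cases "z = s (length z)")
      case True
      then have "z = s (Suc (length x))"
        by (simp add: z)
      then have "x = s (length x)" 
        by (simp add: z spine_Suc)
      then show ?thesis
        using \<open>z = s (Suc (length x))\<close> by (simp add: par_def)
    next
      case False
      then show ?thesis
        using zV by (simp add: par_def z)
    qed
  next
    assume x: "x = z @ [k]"
    show ?thesis
    proof (cases "x = s (length x)")
      case True
      then have "x = s (Suc (length z))"
        by (simp add: x)
      then have "z = s (length z)"
        by (simp add: x spine_Suc)
      then have "par z = x"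
        using \<open>x = s (Suc (length z))\<close> by (simp add: par_def)
      then show ?thesis
        using zV by simp
    next
      case False
      then show ?thesis
        by (simp add: par_def x)
    qed
  qed
next
  have adj: "uh_adj x (par x) \<and> uh_adj (par x) x" for x
  proof (cases "x = s (length x)")
    case True
    then have "par x = x @ [snd (\<sigma> (length x))]"
      by (auto simp: par_def spine_Suc)
    then show ?thesis
      by (auto simp: uh_adj_def)
  next
    case False
    then obtain u k where "x = u @ [k]" "par x = u"
      by (rule off_spine_snoc)
    then show ?thesis
      by (auto simp: uh_adj_def)
  qed
  fix z assume "z \<in> insert (par x) {z \<in> V. par z = x}"
  then show "z \<in> nbrs V uh_adj x"
    using adj[of x] adj[of z] V_par[OF assms] by (auto simp: nbrs_def)
qed

sublocale ended_tree V uh_adj par lvl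
proof unfold_locales
  show "finite (nbrs V uh_adj x)" for x
    unfolding V_eq by (rule finite_nbrs_uh_tree)
qed (auto simp: V_par lvl_par_eq nbrs_par)

text \<open>The first \<open>n\<close> spine vertices with all their bushes: what lies below
  \<open>s n\<close> as seen from the end, though not among its descendants as seen from the
  root.\<close>

definition below :: "nat \<Rightarrow> nat list set" where
  "below n = {x \<in> V. take n x \<noteq> s n}"

lemma below_par: "z \<in> V \<Longrightarrow> par z \<in> below n \<Longrightarrow> z \<in> below n"
proof (rule ccontr)
  assume z: "z \<in> V" "par z \<in> below n" "z \<notin> below n"
  then have tk: "take n z = s n"
    by (simp add: below_def)
  then have len: "n \<le> length z"
    by (metis length_spine length_take min.absorb_iff2)
  have "take n (par z) = s n"
  proof (cases "z = s (length z)")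
    case True
    then show ?thesis
      using len by (simp add: par_def take_spine)
  next
    case False
    then obtain u k where u: "z = u @ [k]" "par z = u"
      by (rule off_spine_snoc)
    have "n \<noteq> length z"
      using tk False by auto
    then show ?thesis
      using tk len u by simp
  qed
  then show False
    using z by (simp add: below_def)
qed

text \<open>On the spine the level equals the index, which is less than \<open>n\<close> here, and
  leaving the spine only lowers it.\<close>

lemma lvl_less_if_not_above: "take n x \<noteq> s n \<Longrightarrow> lvl x < int n"
proof (induction x rule: rev_induct)
  case Nil
  then show ?case
    by (cases n) (auto simp: lvl_def spine_def)
next
  case (snoc k x)
  show ?case
  proof (cases "x @ [k] = s (Suc (length x))")
    case True
    have "lvl (s m) = int m" for m
    proof (induction m)
      case (Suc m)
      then show ?case
        using lvl_snoc[of "s m"] by (simp add: spine_Suc)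
    qed (simp add: lvl_def)
    then have "lvl (x @ [k]) = int (Suc (length x))"
      using True by metis
    moreover have "Suc (length x) < n"
      using snoc.prems True take_spine[of n "Suc (length x)"] by (metis not_less)
    ultimately show ?thesis
      by simp
  next
    case False
    have "take n x \<noteq> s n"
    proof
      assume a: "take n x = s n"
      then have "n \<le> length x"
        by (metis length_spine length_take min.absorb_iff2)
      then show False
        using a snoc.prems by simp
    qed
    then show ?thesis
      using snoc.IH False by (simp add: lvl_snoc)
  qed
qed

lemma lvl_ge: "- int (length x) \<le> lvl x"
proof -
  have "(\<Sum>i<length x. - 1 :: int) \<le> lvl x"
    unfolding lvl_def by (intro sum_mono) auto
  then show ?thesis
    by simp
qed

text \<open>Levels are injective on a ray. In \<open>below n\<close> they are less than
  \<open>n\<close>, and along the ray they only rise from \<open>lvl z\<close>, which is at least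
  \<open>- m\<close> if \<open>z\<close> lies in \<open>below n\<close>.\<close>

lemma card_orb_below:
  assumes "z \<in> V" and len: "\<And>x. x \<in> below n \<Longrightarrow> length x \<le> m" and fin: "finite (below n)"
  shows "card (orb z \<inter> below n) \<le> n + m"
proof (cases "z \<in> below n")
  case True
  have "card (orb z \<inter> below n) = card (lvl ` (orb z \<inter> below n))"
    using orb_inj[OF assms(1)] by (intro card_image[symmetric] inj_onI) auto
  also have "\<dots> \<le> card {- int m..<int n}"
  proof (intro card_mono subsetI)
    fix l assume "l \<in> lvl ` (orb z \<inter> below n)"
    then obtain x where x: "x \<in> orb z" "x \<in> below n" "l = lvl x"
      by auto
    have "lvl x < int n"
      using x(2) by (intro lvl_less_if_not_above) (simp add: below_def)
    moreover have "- int m \<le> lvl x"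
      using lvl_ge[of z] len[OF True] orb_lvl(2)[OF assms(1) x(1)] by simp
    ultimately show "l \<in> {- int m..<int n}"
      by (simp add: x)
  qed simp
  finally show ?thesis
    by simp
next
  case False
  have "(par ^^ k) z \<notin> below n" for k
    by (induction k) (use False below_par funpow_par_in[OF assms(1)] in auto)
  then have "orb z \<inter> below n = {}"
    by (auto simp: orb_def)
  then show ?thesis
    by simp
qed

text \<open>The ray first returns to the vertex where \<open>x\<close> branches off the spine, whose
  index is at most \<open>length x\<close>, and follows the spine from there.\<close>

lemma spine_in_orb:
  assumes "length x \<le> m"
  shows "s m \<in> orb x"
  using assms
proof (induction m rule: dec_induct)
  case base
  show ?case
  proof (induction x rule: rev_induct)
    case Nil
    then show ?case
      using orb_self[of "[]"] by (simp add: spine_def)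
  next
    case (snoc k x)
    show ?case
    proof (cases "x @ [k] = s (length (x @ [k]))")
      case True
      then show ?thesis
        using orb_self by metis
    next
      case False
      then have "par (x @ [k]) = x"
        by (simp add: par_def)
      then have "s (length x) \<in> orb (x @ [k])"
        using snoc orb_unfold[of "x @ [k]"] by simp
      moreover have "par (s (length x)) = s (Suc (length x))"
        by (simp add: par_def)
      ultimately show ?thesis
        using orb_trans orb_par_subset[of "s (length x)"] orb_self[of "s (Suc (length x))"] by force
    qed
  qed
next
  case (step n)
  have "par (s n) = s (Suc n)"
    by (simp add: par_def)
  then show ?case
    using orb_trans[OF step.IH] orb_par_subset[of "s n"] orb_self[of "s (Suc n)"] by auto
qed

text \<open>For \<open>B = below n\<close> with short bushes the kernel is at most
  \<open>n + C * n\<close>, while two fixed vertices share all but boundedly many of the first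
  \<open>n\<close> spine vertices. So the ratio stays away from 0.\<close>

lemma infinite_collision_property_if_short_bushes:
  assumes "\<exists>\<^sub>\<infinity>n. \<forall>x\<in>V. take n x \<noteq> s n \<longrightarrow> length x \<le> C * n"
  shows "infinite_collision_property V uh_adj"
proof (rule infinite_collision_propertyI[where E = "{(x, y). x \<in> V \<and> y \<in> V \<and> even (lvl x + lvl y)}"])
  have lvl_nb: "x' \<in> V \<and> (lvl x' = lvl x + 1 \<or> lvl x' = lvl x - 1)"
    if "x \<in> V" "x' \<in> nbrs V uh_adj x" for x x'
    using that nbrs_eq[OF that(1)] lvl_par par_in by fastforce
  show "(x', y') \<in> {(x, y). x \<in> V \<and> y \<in> V \<and> even (lvl x + lvl y)}"
    if "(x, y) \<in> {(x, y). x \<in> V \<and> y \<in> V \<and> even (lvl x + lvl y)}"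
      "x' \<in> nbrs V uh_adj x" "y' \<in> nbrs V uh_adj y" for x y x' y'
    using that lvl_nb[of x x'] lvl_nb[of y y'] by auto
  show "finite (nbrs V uh_adj v) \<and> nbrs V uh_adj v \<noteq> {}" if "v \<in> V" for v
    using finite_nbrs[OF that] nbrs_eq[OF that] by simp
  show "(\<lambda>m. avoid V uh_adj m x y) \<longlonglongrightarrow> 0"
    if "(x, y) \<in> {(x, y). x \<in> V \<and> y \<in> V \<and> even (lvl x + lvl y)}" for x y
  proof (rule avoid_tendsto_0_if_green[where c = "1 / (2 * (1 + real C))"])
    fix x y assume "x \<in> V" "y \<in> V"
    define N where "N = max (length x) (length y)"
    \<comment> \<open>Both rays contain the spine vertices with index from \<open>N\<close> to
      \<open>n - 1\<close>; \<open>n > 2 * N\<close> makes these more than half of the first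
      \<open>n\<close>, whence the 2 in the constant.\<close>
    obtain n where n: "n > 2 * N" and short: "\<And>x. x \<in> below n \<Longrightarrow> length x \<le> C * n"
      using assms unfolding INFM_nat below_def by blast
    have fin: "finite (below n)"
      by (rule finite_subset[OF _ finite_uh_tree_length_le[of offspring "C * n"]])
        (use short in \<open>auto simp: below_def V_eq\<close>)
    have "s ` {N..<n} \<subseteq> orb x \<inter> orb y \<inter> below n"
    proof
      fix v assume "v \<in> s ` {N..<n}"
      then obtain m where m: "v = s m" "N \<le> m" "m < n"
        by auto
      have "take n (s m) \<noteq> s n"
        using m by (metis length_spine length_take min_less_iff_conj nat_neq_iff)
      then show "v \<in> orb x \<inter> orb y \<inter> below n"
        using m spine_in_orb[of x m] spine_in_orb[of y m] spine_in_V by (auto simp: N_def below_def)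
    qed
    then have "card (s ` {N..<n}) \<le> card (orb x \<inter> orb y \<inter> below n)"
      using fin by (intro card_mono) auto
    moreover have "card (s ` {N..<n}) = n - N"
      by (subst card_image) (auto intro!: inj_onI dest: arg_cong[where f = length])
    ultimately have "real n / 2 \<le> green (below n) x y"
      using n unfolding green_def by linarith
    moreover have "1 / (2 * (1 + real C)) * ((1 + real C) * real n) = real n / 2"
      by (simp add: field_simps)
    ultimately have "1 / (2 * (1 + real C)) * ((1 + real C) * real n) \<le> green (below n) x y"
      by linarith
    moreover have "real (card (orb z \<inter> below n)) \<le> (1 + real C) * real n" if "z \<in> V" for z
    proof -
      have "real (card (orb z \<inter> below n)) \<le> real (n + C * n)"
        using card_orb_below[OF that short fin] by (simp only: of_nat_le_iff)
      then show ?thesis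
        by (simp add: algebra_simps)
    qed
    moreover have "(1 + real C) * real n > 0"
      using n by (simp add: add_pos_nonneg)
    moreover have "below n \<subseteq> V"
      by (auto simp: below_def)
    ultimately show "\<exists>B M. finite B \<and> B \<subseteq> V \<and> (\<forall>z\<in>V. par z \<in> B \<longrightarrow> z \<in> B) \<and>
        M > 0 \<and> (\<forall>z\<in>V. real (card (orb z \<inter> B)) \<le> M) \<and> 1 / (2 * (1 + real C)) * M \<le> green B x y"
      using fin below_par
      by (intro exI[of _ "below n"] exI[of _ "(1 + real C) * real n"] conjI ballI impI) simp_all
  qed (use that in \<open>auto simp: add_pos_nonneg\<close>)
qed auto

end

section \<open>Iterating the generating function\<close>

text \<open>Its mean under a law of mean 1 is \<phi> q = f (1 - q) - (1 - q). Inequalities for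
  \<phi> are proved for each \<open>N\<close> and then integrated.\<close>

definition gf_excess :: "nat \<Rightarrow> real \<Rightarrow> real" where
  "gf_excess N q = (1 - q) ^ N - 1 + real N * q"

lemma gf_excess_eq_sum: "gf_excess N q = q * (\<Sum>i<N. 1 - (1 - q) ^ i)"
proof (induction N)
  case (Suc N)
  have "gf_excess (Suc N) q = gf_excess N q + q * (1 - (1 - q) ^ N)"
    by (simp add: gf_excess_def algebra_simps)
  then show ?case
    using Suc by (simp add: algebra_simps)
qed (simp add: gf_excess_def)

text \<open>Bernoulli's inequality for \<open>(1 + q) ^ i\<close> and
  \<open>(1 - q) * (1 + q) \<le> 1\<close> bound the power by \<open>1 / (1 + i * q)\<close>, which
  is at most \<open>1 - min 1 (i * q) / 2\<close>.\<close>

lemma one_minus_power_ge: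
  fixes q :: real
  assumes "0 \<le> q" "q \<le> 1"
  shows "min 1 (real i * q) / 2 \<le> 1 - (1 - q) ^ i"
proof -
  have "(1 - q) ^ i * (1 + real i * q) \<le> (1 - q) ^ i * (1 + q) ^ i"
    using assms by (intro mult_left_mono Bernoulli_inequality) auto
  also have "\<dots> = (1 - q\<^sup>2) ^ i"
    by (simp add: power_mult_distrib[symmetric] algebra_simps power2_eq_square)
  also have "\<dots> \<le> 1"
    using assms by (intro power_le_one) (auto simp: power_le_one)
  finally have *: "(1 - q) ^ i * (1 + real i * q) \<le> 1" .
  let ?x = "real i * q"
  have x: "?x \<ge> 0"
    using assms by simp
  have "(1 - q) ^ i \<le> 1 / (1 + ?x)"
    using * x by (simp add: pos_le_divide_eq)
  also have "1 / (1 + ?x) \<le> 1 - min 1 ?x / 2"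
  proof (cases "?x \<le> 1")
    case True
    have "(1 + ?x) * (1 - ?x / 2) = 1 + ?x * (1 - ?x) / 2"
      by (simp add: field_simps)
    also have "\<dots> \<ge> 1"
      using True x by simp
    finally show ?thesis
      using True x by (simp add: divide_le_eq mult.commute min_def)
  next
    case False
    then show ?thesis
      by (simp add: field_simps)
  qed
  finally show ?thesis
    by simp
qed

text \<open>Divided by \<open>q\<close>, the left side is a size-biased union bound: weight
  \<open>N\<close> for the bias, \<open>N - 1\<close> for the children other than the chosen one. By
  concavity \<open>min 1 (i * q)\<close> is at least \<open>i / (N - 1)\<close> times its value at
  \<open>i = N - 1\<close>; summing over \<open>i < N\<close> costs a factor 2, and
  \<open>one_minus_power_ge\<close> another.\<close>

lemma gf_excess_ge:
  assumes q: "0 \<le> q" "q \<le> 1"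
  shows "q * (real N * min 1 (real (N - 1) * q)) \<le> 4 * gf_excess N q"
proof (cases "N \<le> 1")
  case True
  then have "N = 0 \<or> N = 1"
    by auto
  then show ?thesis
    by (auto simp: gf_excess_def)
next
  case False
  let ?m = "min 1 (real (N - 1) * q)"
  have "(\<Sum>i<N. real i / real (N - 1) * ?m) \<le> (\<Sum>i<N. 2 * (1 - (1 - q) ^ i))"
  proof (rule sum_mono)
    fix i assume i: "i \<in> {..<N}"
    have "real i / real (N - 1) * ?m \<le> min 1 (real i * q)"
    proof (rule min.boundedI)
      have "real i / real (N - 1) * ?m \<le> 1 * 1"
        using i q False by (intro mult_mono) (auto simp: divide_le_eq)
      then show "real i / real (N - 1) * ?m \<le> 1"
        by simp
      have "real i / real (N - 1) * ?m \<le> real i / real (N - 1) * (real (N - 1) * q)"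
        by (intro mult_left_mono) auto
      then show "real i / real (N - 1) * ?m \<le> real i * q"
        using False by simp
    qed
    also have "\<dots> \<le> 2 * (1 - (1 - q) ^ i)"
      using one_minus_power_ge[OF q, of i] by simp
    finally show "real i / real (N - 1) * ?m \<le> 2 * (1 - (1 - q) ^ i)" .
  qed
  also have "(\<Sum>i<N. real i / real (N - 1) * ?m) = real N / 2 * ?m"
  proof -
    have "(\<Sum>i<N. real i) = real N * real (N - 1) / 2"
    proof (induction N)
      case (Suc N)
      then show ?case
        by (cases N) (auto simp: field_simps)
    qed simp
    moreover have "(\<Sum>i<N. real i / real (N - 1) * ?m) = (\<Sum>i<N. real i) / real (N - 1) * ?m"
      by (simp add: sum_distrib_right sum_divide_distrib)
    ultimately have "(\<Sum>i<N. real i / real (N - 1) * ?m) = (real N * real (N - 1) / 2) / real (N - 1) * ?m"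
      by (simp only:)
    moreover have "real (N - 1) \<noteq> 0"
      using False by simp
    ultimately show ?thesis
      by (simp del: of_nat_diff)
  qed
  finally have "real N / 2 * ?m \<le> 2 * (\<Sum>i<N. 1 - (1 - q) ^ i)"
    by (simp only: sum_distrib_left)
  then have "real N * ?m \<le> 4 * (\<Sum>i<N. 1 - (1 - q) ^ i)"
    by simp
  then have "q * (real N * ?m) \<le> q * (4 * (\<Sum>i<N. 1 - (1 - q) ^ i))"
    using q by (intro mult_left_mono)
  then show ?thesis
    by (simp add: gf_excess_eq_sum mult.left_commute)
qed

lemma gf_excess_nonneg: "0 \<le> q \<Longrightarrow> q \<le> 1 \<Longrightarrow> 0 \<le> gf_excess N q"
  unfolding gf_excess_eq_sum by (intro mult_nonneg_nonneg sum_nonneg) (auto intro: power_le_one)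

text \<open>Each summand \<open>1 - (1 - q) ^ i\<close> grows with \<open>q\<close>; multiplying out
  the quotients keeps \<open>q = 0\<close> admissible.\<close>

lemma gf_excess_ratio_mono:
  assumes "0 \<le> q" "q \<le> r" "r \<le> 1"
  shows "r * gf_excess N q \<le> q * gf_excess N r"
proof -
  have "(\<Sum>i<N. 1 - (1 - q) ^ i) \<le> (\<Sum>i<N. 1 - (1 - r) ^ i)"
    using assms by (intro sum_mono diff_left_mono power_mono) auto
  then have "(r * q) * (\<Sum>i<N. 1 - (1 - q) ^ i) \<le> (r * q) * (\<Sum>i<N. 1 - (1 - r) ^ i)"
    using assms by (intro mult_left_mono) auto
  then show ?thesis
    by (simp add: gf_excess_eq_sum mult_ac)
qed

lemma convex_on_gf_excess: "convex_on {0..1} (gf_excess N)"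
proof -
  have "convex_on {0..1} (\<lambda>q :: real. (1 - q) ^ N)"
  proof (rule convex_onI)
    fix t x y :: real assume t: "0 < t" "t < 1" and xy: "x \<in> {0..1}" "y \<in> {0..1}"
    have "convex_on {0..} (\<lambda>x :: real. x ^ N)"
      by (cases "even N") (auto intro: convex_on_subset[OF convex_power_even] convex_power_odd)
    from convex_onD[OF this, of t "1 - x" "1 - y"]
    show "(1 - ((1 - t) *\<^sub>R x + t *\<^sub>R y)) ^ N \<le> (1 - t) * (1 - x) ^ N + t * (1 - y) ^ N"
      using t xy by (simp add: algebra_simps)
  qed simp
  moreover have "convex_on {0..1} (\<lambda>q :: real. - 1 + real N * q)"
    by (rule convex_onI) (auto simp: algebra_simps)
  ultimately have "convex_on {0..1} (\<lambda>q. (1 - q) ^ N + (- 1 + real N * q))"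
    by (rule convex_on_add)
  then show ?thesis
    by (simp add: gf_excess_def[abs_def] algebra_simps)
qed

text \<open>A discrete form of y' = - y^2 for \<open>y = c * x m\<close>: if
  \<open>m * y \<le> 1\<close> and \<open>y \<le> 1\<close>, then
  \<open>(m + 1) * (y * (1 - y)) \<le> 1 - y * y\<close>; for \<open>y > 1\<close> the left side is
  negative.\<close>

lemma logistic_decay:
  fixes x :: "nat \<Rightarrow> real"
  assumes "\<And>m. 0 \<le> x m" "c > 0" "\<And>m. x (Suc m) \<le> x m * (1 - c * x m)"
  shows "c * real m * x m \<le> 1"
proof (induction m)
  case (Suc m)
  let ?y = "c * x m"
  have y: "0 \<le> ?y"
    using assms by simp
  have "c * real (Suc m) * x (Suc m) \<le> real (Suc m) * (?y * (1 - ?y))"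
    using mult_left_mono[OF assms(3)[of m], of "c * real (Suc m)"] assms(2) by (simp add: mult_ac)
  also have "\<dots> \<le> 1"
  proof -
    have my: "real m * ?y \<le> 1"
      using Suc by (simp add: mult_ac)
    show ?thesis
    proof (cases "?y \<le> 1")
      case True
      have "real (Suc m) * (?y * (1 - ?y)) = (real m * ?y) * (1 - ?y) + ?y * (1 - ?y)"
        by (simp add: algebra_simps)
      also have "\<dots> \<le> 1 * (1 - ?y) + ?y * (1 - ?y)"
        using True my by (intro add_right_mono mult_right_mono) auto
      also have "\<dots> = 1 - ?y * ?y"
        by (simp add: algebra_simps)
      also have "\<dots> \<le> 1"
        by simp
      finally show ?thesis .
    next
      case False
      then have "real (Suc m) * (?y * (1 - ?y)) \<le> 0"
        using y by (intro mult_nonneg_nonpos) auto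
      then show ?thesis
        by simp
    qed
  qed
  finally show ?case .
qed simp

text \<open>With \<open>\<psi> q = \<phi> q / q\<close> the iteration gives \<open>\<psi> q' \<le> \<psi> q * (1 - c * \<psi> q)\<close> for consecutive \<open>q\<close>, \<open>q'\<close>.\<close>

lemma iteration_ratio_bound:
  fixes \<phi> :: "real \<Rightarrow> real" and Q :: "nat \<Rightarrow> real"
  assumes conv: "convex_on {0..1} \<phi>"
    and range: "\<And>q. 0 \<le> q \<Longrightarrow> q \<le> 1 \<Longrightarrow> 0 \<le> \<phi> q \<and> \<phi> q \<le> q"
    and ratio: "\<And>q r. 0 \<le> q \<Longrightarrow> q \<le> r \<Longrightarrow> r \<le> 1 \<Longrightarrow> r * \<phi> q \<le> q * \<phi> r"
    and \<delta>: "\<delta> > 0" "\<And>q. 0 < q \<Longrightarrow> q < \<delta> \<Longrightarrow> 0 < \<phi> q \<and> \<phi> (q / 2) \<le> \<theta> * \<phi> q"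
    and \<theta>: "\<theta> < 1 / 2"
    and Q: "0 \<le> Q 0" "Q 0 \<le> 1" "\<And>m. Q (Suc m) = Q m - \<phi> (Q m)"
  shows "\<exists>K m0. \<forall>m\<ge>m0. real m * (\<phi> (Q m) / Q m) \<le> K"
proof -
  have Q01: "0 \<le> Q m \<and> Q m \<le> 1" for m
  proof (induction m)
    case (Suc m)
    then show ?case
      using Q(3)[of m] range[of "Q m"] by simp
  qed (use Q in simp)
  have mono: "\<phi> q \<le> \<phi> r" if "0 \<le> q" "q \<le> r" "r \<le> 1" for q r
  proof (cases "r = 0")
    case False
    then have "r * \<phi> q \<le> r * \<phi> r"
      using ratio[OF that] range[of r] that mult_right_mono[of q r "\<phi> r"] by linarith
    then show ?thesis
      using False that by auto
  qed (use that in auto)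
  have dec: "Q (Suc m) \<le> Q m" for m
    using Q(3) range Q01 by auto
  \<comment> \<open>Otherwise each step would lower \<open>Q\<close> by at least
    \<open>\<phi> (\<delta> / 2)\<close>. The argument is halved because positivity is assumed only
    strictly below \<delta>.\<close>
  have "\<exists>m0. Q m0 < \<delta>"
  proof (rule ccontr)
    assume "\<not> ?thesis"
    then have big: "Q m \<ge> \<delta>" for m
      by (meson not_less)
    let ?e = "\<phi> (\<delta> / 2)"
    have e: "?e > 0"
      using \<delta>(2)[of "\<delta> / 2"] \<delta>(1) by auto
    have le: "?e \<le> \<phi> (Q m)" for m
      using big[of m] Q01[of m] \<delta>(1) by (intro mono) auto
    have "Q m \<le> 1 - real m * ?e" for m
    proof (induction m)
      case (Suc m)
      then show ?case
        using Q(3)[of m] le[of m] by (simp add: algebra_simps)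
    qed (use Q in simp)
    moreover obtain m where "real m * ?e > 1"
      using reals_Archimedean3[OF e] by blast
    ultimately show False
      using Q01[of m] by (smt (verit))
  qed
  then obtain m0 where m0: "Q m0 < \<delta>"
    by blast
  have small: "Q (m0 + m) < \<delta>" for m
    by (induction m) (use m0 dec in \<open>auto intro: le_less_trans\<close>)
  define x where "x m = \<phi> (Q (m0 + m)) / Q (m0 + m)" for m
  define c where "c = 1 - 2 * \<theta>"
  have c: "c > 0"
    using \<theta> by (simp add: c_def)
  \<comment> \<open>This gives \<open>c \<le> 1\<close>, so that \<open>1 - c * e\<close> is
    nonnegative below.\<close>
  have \<theta>0: "\<theta> \<ge> 0"
  proof -
    let ?q = "min \<delta> 1 / 2"
    have "0 < \<phi> ?q" "\<phi> (?q / 2) \<le> \<theta> * \<phi> ?q"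
      using \<delta>(2)[of ?q] \<delta>(1) by auto
    moreover have "0 \<le> \<phi> (?q / 2)"
      using range[of "?q / 2"] \<delta>(1) by auto
    ultimately show ?thesis
      by (smt (verit) mult_neg_pos)
  qed
  have x0: "0 \<le> x m" for m
    using range[of "Q (m0 + m)"] Q01[of "m0 + m"] by (simp add: x_def)
  have step: "x (Suc m) \<le> x m * (1 - c * x m)" for m
  proof -
    define q where "q = Q (m0 + m)"
    define e where "e = \<phi> q / q"
    define q' where "q' = Q (m0 + Suc m)"
    have q01: "0 \<le> q" "q \<le> 1"
      using Q01 by (auto simp: q_def)
    have q': "q' = q - \<phi> q"
      by (simp add: q'_def q_def Q(3))
    have q'01: "0 \<le> q'" "q' \<le> 1"
      using Q01 by (auto simp: q'_def)
    have e01: "0 \<le> e" "e \<le> 1"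
      using range[OF q01] q01 by (auto simp: e_def divide_le_eq)
    have ce: "c * e \<le> 1"
      using e01 c \<theta>0 mult_mono[of c 1 e 1] by (simp add: c_def)
    have x_eq: "x m = e" "x (Suc m) = \<phi> q' / q'"
      by (simp_all add: x_def e_def q_def q'_def)
    show ?thesis
    proof (cases "q = 0 \<or> q' = 0")
      case True
      \<comment> \<open>Either way \<open>q' = 0\<close>, and the quotient
        \<open>\<phi> q' / q'\<close> is 0 by convention.\<close>
      have "q = 0 \<Longrightarrow> q' = 0"
        using range[of q] q' by simp
      then have "q' = 0"
        using True by blast
      then show ?thesis
        unfolding x_eq using e01 ce by simp
    next
      case False
      then have pos: "q > 0" "q' > 0"
        using q01 q'01 by auto
      have q\<delta>: "q < \<delta>"
        using small by (simp add: q_def)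
      have phi_q: "\<phi> q = e * q"
        using pos by (simp add: e_def)
      have half: "\<phi> (q / 2) \<le> \<theta> * (e * q)"
        using \<delta>(2)[OF pos(1) q\<delta>] by (simp add: phi_q)
      have q'e: "q' = q * (1 - e)"
        by (simp add: q' phi_q algebra_simps)
      have "\<phi> q' \<le> (e * (1 - c * e)) * q'"
      \<comment> \<open>For \<open>e \<le> 1 / 2\<close> the point \<open>q'\<close> is a convex
        combination of \<open>q\<close> and \<open>q / 2\<close> with weight \<open>2 * e\<close> on
        the latter, so convexity brings in the halving bound. For larger \<open>e\<close> it lies
        below \<open>q / 2\<close>, where monotonicity of \<open>\<phi> q / q\<close>
        suffices.\<close>
      proof (cases "e \<le> 1 / 2")
        case True
        have "q' = (1 - 2 * e) *\<^sub>R q + (2 * e) *\<^sub>R (q / 2)"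
          by (simp add: q'e algebra_simps)
        then have "\<phi> q' \<le> (1 - 2 * e) * \<phi> q + (2 * e) * \<phi> (q / 2)"
          using convex_onD[OF conv, of "2 * e" q "q / 2"] True e01 q01 by simp
        also have "\<dots> \<le> (1 - 2 * e) * (e * q) + (2 * e) * (\<theta> * (e * q))"
          using half e01 True by (intro add_mono mult_left_mono) (auto simp: phi_q)
        also have "\<dots> = (e * (1 - c * e)) * q' - c * (e * e * e * q)"
          by (simp add: q'e c_def algebra_simps)
        also have "\<dots> \<le> (e * (1 - c * e)) * q'"
          using c e01 pos by simp
        finally show ?thesis .
      next
        case False
        have "q' \<le> q / 2"
          using False pos by (simp add: q'e algebra_simps)
        then have "(q / 2) * \<phi> q' \<le> q' * \<phi> (q / 2)"
          using q01 q'01 by (intro ratio) auto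
        also have "\<dots> \<le> q' * (\<theta> * (e * q))"
          using half pos by (intro mult_left_mono) auto
        also have "\<dots> = (q / 2) * ((e * (1 - c)) * q')"
          by (simp add: c_def)
        finally have "\<phi> q' \<le> (e * (1 - c)) * q'"
          using pos by simp
        also have "\<dots> \<le> (e * (1 - c * e)) * q'"
          using e01 c pos by (intro mult_right_mono mult_left_mono) auto
        finally show ?thesis .
      qed
      then show ?thesis
        unfolding x_eq using pos by (simp add: pos_divide_le_eq)
    qed
  qed
  show ?thesis
  proof (intro exI allI impI)
    \<comment> \<open>For \<open>m \<ge> 2 * m0\<close>, replacing \<open>m - m0\<close> by
      \<open>m\<close> costs at most a factor 2.\<close>
    fix m assume m: "m \<ge> 2 * m0"
    define k where "k = m - m0"
    have mk: "m = m0 + k" "real m \<le> 2 * real k"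
      using m by (auto simp: k_def)
    have "real m * x k \<le> 2 * real k * x k"
      using mk x0 by (intro mult_right_mono) auto
    also have "\<dots> \<le> 2 / c"
      using logistic_decay[of x c k, OF x0 c step] c by (simp add: field_simps)
    finally show "real m * (\<phi> (Q m) / Q m) \<le> 2 / c"
      by (simp add: x_def mk)
  qed
qed

section \<open>Heights of Galton--Watson trees\<close>

definition pmf_excess :: "nat pmf \<Rightarrow> real \<Rightarrow> real" where
  "pmf_excess p q = (\<integral>k. gf_excess k q \<partial>measure_pmf p)"

section \<open>The excess \<phi> of a critical offspring law\<close>

locale critical_offspring =
  fixes p :: "nat pmf"
  assumes integrable_offspring: "integrable (measure_pmf p) real"
    and mean_offspring: "measure_pmf.expectation p real = 1"
begin

lemma integrable_power_pmf:
  fixes s :: real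
  assumes "0 \<le> s" "s \<le> 1"
  shows "integrable (measure_pmf p) (\<lambda>k. s ^ k)"
  using assms by (intro measure_pmf.integrable_const_bound[where B = 1]) (auto intro!: AE_I2 power_le_one)

lemma integrable_gf_excess:
  assumes "0 \<le> q" "q \<le> 1"
  shows "integrable (measure_pmf p) (\<lambda>k. gf_excess k q)"
  unfolding gf_excess_def using assms integrable_offspring
  by (intro Bochner_Integration.integrable_add Bochner_Integration.integrable_diff
      integrable_power_pmf integrable_mult_left) auto

lemma pmf_excess_eq:
  assumes "0 \<le> q" "q \<le> 1"
  shows "pmf_excess p q = (\<integral>k. (1 - q) ^ k \<partial>measure_pmf p) - (1 - q)"
proof -
  have "pmf_excess p q = (\<integral>k. (1 - q) ^ k \<partial>measure_pmf p) - 1 + measure_pmf.expectation p real * q"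
    unfolding pmf_excess_def gf_excess_def using assms integrable_offspring integrable_power_pmf[of "1 - q"]
    by simp
  then show ?thesis
    by (simp add: mean_offspring)
qed

lemma pmf_excess_range:
  assumes "0 \<le> q" "q \<le> 1"
  shows "0 \<le> pmf_excess p q" "pmf_excess p q \<le> q"
proof -
  show "0 \<le> pmf_excess p q"
    unfolding pmf_excess_def using assms by (intro integral_nonneg_AE AE_I2 gf_excess_nonneg)
  have "(\<integral>k. (1 - q) ^ k \<partial>measure_pmf p) \<le> (\<integral>k. 1 \<partial>measure_pmf p)"
    using assms by (intro integral_mono integrable_power_pmf) (auto intro: power_le_one)
  then show "pmf_excess p q \<le> q"
    using assms by (simp add: pmf_excess_eq)
qed

lemma pmf_excess_ratio_mono:
  assumes "0 \<le> q" "q \<le> r" "r \<le> 1"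
  shows "r * pmf_excess p q \<le> q * pmf_excess p r"
proof -
  have "(\<integral>k. r * gf_excess k q \<partial>measure_pmf p) \<le> (\<integral>k. q * gf_excess k r \<partial>measure_pmf p)"
    using assms by (intro integral_mono integrable_mult_right integrable_gf_excess gf_excess_ratio_mono) auto
  then show ?thesis
    by (simp add: pmf_excess_def)
qed

lemma convex_on_pmf_excess: "convex_on {0..1} (pmf_excess p)"
proof (rule convex_onI)
  fix t x y :: real assume t: "0 < t" "t < 1" and xy: "x \<in> {0..1}" "y \<in> {0..1}"
  have mem: "(1 - t) * x + t * y \<in> {0..1}"
    using convexD[of "{0..1::real}" x y "1 - t" t] t xy by auto
  have int: "integrable (measure_pmf p) (\<lambda>k. gf_excess k x)" "integrable (measure_pmf p) (\<lambda>k. gf_excess k y)"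
    using xy by (auto intro: integrable_gf_excess)
  have "pmf_excess p ((1 - t) * x + t * y) \<le>
      (\<integral>k. (1 - t) * gf_excess k x + t * gf_excess k y \<partial>measure_pmf p)"
    unfolding pmf_excess_def
    using mem t xy convex_onD[OF convex_on_gf_excess, of t x y]
    by (intro integral_mono integrable_gf_excess Bochner_Integration.integrable_add integrable_mult_right int) auto
  also have "\<dots> = (1 - t) * pmf_excess p x + t * pmf_excess p y"
    using int by (simp add: pmf_excess_def)
  finally show "pmf_excess p ((1 - t) *\<^sub>R x + t *\<^sub>R y) \<le> (1 - t) * pmf_excess p x + t * pmf_excess p y"
    by simp
qed simp

text \<open>Under \<open>p\<close> the integrand gains the weight \<open>k\<close>, and
  \<open>gf_excess_ge\<close> can be integrated. The integrand is the union bound for one of the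
  \<open>k - 1\<close> other children of a spine vertex to start a tree with a property of
  probability \<open>q\<close>.\<close>

lemma size_biased_integral_le:
  assumes q: "0 < q" "q \<le> 1"
  shows "(\<integral>\<^sup>+k. ennreal (min 1 (real (k - 1) * q)) \<partial>measure_pmf (size_biased p))
    \<le> ennreal (4 * (pmf_excess p q / q))"
proof -
  have "(\<integral>\<^sup>+k. ennreal (min 1 (real (k - 1) * q)) \<partial>measure_pmf (size_biased p)) =
     (\<integral>\<^sup>+k. ennreal (real k * min 1 (real (k - 1) * q)) \<partial>measure_pmf p)"
    using q by (simp add: nn_integral_measure_pmf pmf_size_biased[OF mean_offspring] ennreal_mult[symmetric] mult_ac)
  also have "\<dots> \<le> (\<integral>\<^sup>+k. ennreal (4 / q * gf_excess k q) \<partial>measure_pmf p)"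
  proof (intro nn_integral_mono ennreal_leI)
    fix k
    show "real k * min 1 (real (k - 1) * q) \<le> 4 / q * gf_excess k q"
      using gf_excess_ge[of q k] q by (simp add: field_simps)
  qed
  also have "\<dots> = ennreal (\<integral>k. 4 / q * gf_excess k q \<partial>measure_pmf p)"
    using q by (intro nn_integral_eq_integral integrable_mult_right integrable_gf_excess)
      (auto intro!: AE_I2 gf_excess_nonneg divide_nonneg_nonneg)
  finally show ?thesis
    by (simp add: pmf_excess_def)
qed

end

section \<open>The event of reaching a given height and its recursion\<close>

definition tall :: "nat \<Rightarrow> (nat list \<Rightarrow> nat) \<Rightarrow> bool" where
  "tall m \<omega> \<longleftrightarrow> (\<exists>u\<in>uh_tree \<omega>. length u = m)"

lemma uh_tree_Cons: "j # u \<in> uh_tree \<omega> \<longleftrightarrow> j < \<omega> [] \<and> u \<in> uh_tree (\<lambda>v. \<omega> (j # v))"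
  by (simp add: uh_tree_iff All_less_Suc2)

lemma tall_Suc: "tall (Suc m) \<omega> \<longleftrightarrow> (\<exists>j<\<omega> []. tall m (\<lambda>v. \<omega> (j # v)))"
proof -
  have "tall (Suc m) \<omega> \<longleftrightarrow> (\<exists>j u. j # u \<in> uh_tree \<omega> \<and> length u = m)"
    unfolding tall_def by (metis length_Suc_conv)
  then show ?thesis
    by (auto simp: tall_def uh_tree_Cons)
qed

definition offspring_space :: "nat pmf \<Rightarrow> (nat list \<Rightarrow> nat) measure" where
  "offspring_space p = (\<Pi>\<^sub>M u\<in>UNIV. measure_pmf p)"

lemma sets_offspring_space [measurable_cong]:
  "sets (offspring_space p) = sets (\<Pi>\<^sub>M u\<in>UNIV. count_space UNIV)"
  unfolding offspring_space_def by (intro sets_PiM_cong) auto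

lemma space_offspring_space [simp]: "space (offspring_space p) = UNIV"
  by (simp add: offspring_space_def space_PiM)

lemma prob_space_offspring_space: "prob_space (offspring_space p)"
  unfolding offspring_space_def by (intro prob_space_PiM prob_space_measure_pmf)

lemma measurable_tall [measurable]:
  "Measurable.pred (\<Pi>\<^sub>M u\<in>UNIV. count_space UNIV) (tall m)"
proof -
  have "tall m = (\<lambda>\<omega>. \<exists>u\<in>{u. length u = m}. \<forall>i\<in>{..<length u}. u ! i < \<omega> (take i u))"
    by (auto simp: tall_def uh_tree_iff fun_eq_iff)
  also have "Measurable.pred (\<Pi>\<^sub>M u\<in>UNIV. count_space UNIV) \<dots>"
    by measurable
  finally show ?thesis .
qed

text \<open>Prefixing by \<open>w\<close> is an injective relabelling of an i.i.d. family, so the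
  tree rooted at any address has the same law.\<close>

lemma distr_offspring_space_shift:
  "distr (offspring_space p) (offspring_space p) (\<lambda>\<omega> u. \<omega> (w @ u)) = offspring_space p"
  using distr_PiM_reindex[of UNIV "\<lambda>_. measure_pmf p" "\<lambda>u. w @ u" UNIV]
  by (simp add: offspring_space_def inj_on_def prob_space_measure_pmf restrict_UNIV)

lemma prob_tall_shift:
  "measure (offspring_space p) {\<omega>. tall m (\<lambda>u. \<omega> (w @ u))} = measure (offspring_space p) {\<omega>. tall m \<omega>}"
proof -
  have "measure (offspring_space p) {\<omega>. tall m \<omega>} =
      measure (distr (offspring_space p) (offspring_space p) (\<lambda>\<omega> u. \<omega> (w @ u))) {\<omega>. tall m \<omega>}"
    by (simp add: distr_offspring_space_shift)
  also have "\<dots> = measure (offspring_space p) {\<omega>. tall m (\<lambda>u. \<omega> (w @ u))}"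
  proof (subst measure_distr)
    show "(\<lambda>\<omega> u. \<omega> (w @ u)) \<in> offspring_space p \<rightarrow>\<^sub>M offspring_space p"
      unfolding offspring_space_def by (rule measurable_PiM_single') auto
    show "{\<omega>. tall m \<omega>} \<in> sets (offspring_space p)"
      using measurable_tall[of m] unfolding pred_def by (simp add: sets_offspring_space space_PiM)
  qed (simp add: vimage_def)
  finally show ?thesis ..
qed

lemma indep_vars_offspring_space:
  "prob_space.indep_vars (offspring_space p) (\<lambda>_. count_space UNIV) (\<lambda>u \<omega>. \<omega> u) UNIV"
proof -
  interpret prob_space "offspring_space p" by (rule prob_space_offspring_space)
  have [measurable]: "(\<lambda>\<omega>. \<omega> u) \<in> offspring_space p \<rightarrow>\<^sub>M count_space UNIV" for u
    by measurable
  have "distr (offspring_space p) (count_space UNIV) (\<lambda>\<omega>. \<omega> u) = measure_pmf p" for u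
    using distr_PiM_component[of UNIV "\<lambda>_. measure_pmf p" u]
      distr_cong[of "offspring_space p" "offspring_space p" "count_space UNIV" "measure_pmf p" "\<lambda>\<omega>. \<omega> u" "\<lambda>\<omega>. \<omega> u"]
    by (simp add: offspring_space_def prob_space_measure_pmf)
  moreover have "distr (offspring_space p) (\<Pi>\<^sub>M u\<in>UNIV. count_space UNIV) (\<lambda>\<omega>. \<lambda>u\<in>UNIV. \<omega> u) = offspring_space p"
    by (simp add: restrict_UNIV distr_id2 sets_offspring_space)
  ultimately show ?thesis
    by (subst indep_vars_iff_distr_eq_PiM) (auto simp: offspring_space_def)
qed

text \<open>The branching property: given the number of children of the root, their subtrees are
  independent copies, and the whole tree fails to reach height \<open>m + 1\<close> if each of them
  fails to reach height \<open>m\<close>.\<close>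

lemma prob_tall_Suc:
  "measure (offspring_space p) {\<omega>. tall (Suc m) \<omega>} =
     1 - (\<integral>k. (1 - measure (offspring_space p) {\<omega>. tall m \<omega>}) ^ k \<partial>measure_pmf p)"
proof -
  let ?W = "offspring_space p"
  interpret W: prob_space ?W by (rule prob_space_offspring_space)
  define q where "q = W.prob {\<omega>. tall m \<omega>}"
  \<comment> \<open>Independence comes from disjoint blocks of addresses: block 0 is the root, block
    \<open>j + 1\<close> the subtree of child \<open>j\<close>.\<close>
  define K where "K i = (if i = 0 then {[]} else range (\<lambda>u. (i - 1) # u))" for i :: nat
  have disj: "disjoint_family_on K UNIV"
    by (auto simp: disjoint_family_on_def K_def)
  have ind: "W.indep_vars (\<lambda>i. PiM (K i) (\<lambda>_. count_space UNIV)) (\<lambda>i \<omega>. restrict \<omega> (K i)) UNIV"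
    using W.indep_vars_restrict[OF indep_vars_offspring_space _ disj] by simp
  define A where "A n i = (if i = 0 then {f \<in> space (PiM (K i) (\<lambda>_. count_space UNIV)). f [] = n}
     else {f \<in> space (PiM (K i) (\<lambda>_. count_space UNIV)). \<not> tall m (\<lambda>u. f ((i - 1) # u))})" for n i :: nat
  have A_sets: "A n i \<in> sets (PiM (K i) (\<lambda>_. count_space UNIV))" for n i
  proof (cases "i = 0")
    case True
    have [measurable]: "(\<lambda>f. f []) \<in> PiM (K i) (\<lambda>_. count_space UNIV) \<rightarrow>\<^sub>M count_space UNIV"
      using True by (intro measurable_component_singleton) (auto simp: K_def)
    show ?thesis
      unfolding A_def if_P[OF True] by measurable
  next
    case False
    have [measurable]: "(\<lambda>f u. f ((i - 1) # u)) \<in> PiM (K i) (\<lambda>_. count_space UNIV) \<rightarrow>\<^sub>M 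
        (\<Pi>\<^sub>M u\<in>UNIV. count_space UNIV)"
      using False by (intro measurable_PiM_single' measurable_component_singleton) (auto simp: K_def)
    show ?thesis
      unfolding A_def if_not_P[OF False] by measurable
  qed
  have vim: "(\<lambda>\<omega>. restrict \<omega> (K i)) -` A n i \<inter> space ?W =
     (if i = 0 then {\<omega>. \<omega> [] = n} else {\<omega>. \<not> tall m (\<lambda>u. \<omega> ((i - 1) # u))})" for n i
    by (auto simp: A_def K_def space_PiM)
  have root: "W.prob {\<omega>. \<omega> [] = n} = pmf p n" for n
  proof -
    have "distr ?W (measure_pmf p) (\<lambda>\<omega>. \<omega> []) = measure_pmf p"
      using distr_PiM_component[of UNIV "\<lambda>_. measure_pmf p" "[]"]
      by (simp add: offspring_space_def prob_space_measure_pmf)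
    then have "pmf p n = measure (distr ?W (measure_pmf p) (\<lambda>\<omega>. \<omega> [])) {n}"
      by (simp add: measure_pmf_single)
    also have "\<dots> = W.prob {\<omega>. \<omega> [] = n}"
      by (subst measure_distr) (auto simp: vimage_def)
    finally show ?thesis ..
  qed
  have tall_sets: "{\<omega>. tall m (\<lambda>u. \<omega> (w @ u))} \<in> W.events" for w
  proof -
    have [measurable]: "(\<lambda>\<omega> u. \<omega> (w @ u)) \<in> ?W \<rightarrow>\<^sub>M (\<Pi>\<^sub>M u\<in>UNIV. count_space UNIV)"
      by (intro measurable_PiM_single') auto
    have "Measurable.pred ?W (\<lambda>\<omega>. tall m (\<lambda>u. \<omega> (w @ u)))"
      by measurable
    then show ?thesis
      by (simp add: pred_def)
  qed
  have sub: "W.prob {\<omega>. \<not> tall m (\<lambda>u. \<omega> (j # u))} = 1 - q" for j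
  proof -
    have "W.prob (space ?W - {\<omega>. tall m (\<lambda>u. \<omega> ([j] @ u))}) = 1 - W.prob {\<omega>. tall m (\<lambda>u. \<omega> ([j] @ u))}"
      by (rule W.prob_compl[OF tall_sets])
    also have "space ?W - {\<omega>. tall m (\<lambda>u. \<omega> ([j] @ u))} = {\<omega>. \<not> tall m (\<lambda>u. \<omega> (j # u))}"
      by auto
    finally show ?thesis
      by (simp add: prob_tall_shift[of p m "[j]", simplified] q_def)
  qed
  \<comment> \<open>The complementary event, split by the number of children of the root.\<close>
  define D where "D n = {\<omega>. \<omega> [] = n \<and> (\<forall>j<n. \<not> tall m (\<lambda>u. \<omega> (j # u)))}" for n
  have D_eq: "D n = (\<Inter>i\<in>{..n}. (\<lambda>\<omega>. restrict \<omega> (K i)) -` A n i \<inter> space ?W)" for n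
  proof -
    have "{..n} = insert 0 (Suc ` {..<n})"
      by (simp only: lessThan_Suc_atMost[symmetric] lessThan_Suc_eq_insert_0)
    then have "(\<Inter>i\<in>{..n}. (\<lambda>\<omega>. restrict \<omega> (K i)) -` A n i \<inter> space ?W) =
        {\<omega>. \<omega> [] = n} \<inter> (\<Inter>j\<in>{..<n}. {\<omega>. \<not> tall m (\<lambda>u. \<omega> (j # u))})"
      by (simp only: vim INT_insert image_image refl if_True if_False nat.distinct diff_Suc_1)
    then show ?thesis
      unfolding D_def by auto
  qed
  have D_prob: "W.prob (D n) = pmf p n * (1 - q) ^ n" for n
  proof -
    have "W.prob (D n) = (\<Prod>i\<in>{..n}. W.prob ((\<lambda>\<omega>. restrict \<omega> (K i)) -` A n i \<inter> space ?W))"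
      unfolding D_eq by (rule W.indep_varsD[OF ind]) (auto simp: A_sets)
    also have "\<dots> = (\<Prod>i\<in>{..n}. if i = 0 then pmf p n else 1 - q)"
      by (intro prod.cong refl) (simp only: vim, simp add: root sub)
    also have "\<dots> = pmf p n * (1 - q) ^ n"
      by (simp add: prod.atMost_shift)
    finally show ?thesis .
  qed
  have D_sets: "D n \<in> W.events" for n
  proof -
    have "(\<lambda>\<omega>. restrict \<omega> (K i)) \<in> ?W \<rightarrow>\<^sub>M PiM (K i) (\<lambda>_. count_space UNIV)" for i
      using ind by (simp add: W.indep_vars_def)
    from measurable_sets[OF this A_sets] show ?thesis
      unfolding D_eq by (intro sets.finite_INT) auto
  qed
  have "(\<lambda>n. W.prob (D n)) sums W.prob (\<Union>n. D n)"
    using D_sets by (intro W.finite_measure_UNION) (auto simp: disjoint_family_on_def D_def)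
  moreover have "(\<Union>n. D n) = space ?W - {\<omega>. tall (Suc m) \<omega>}"
    by (auto simp: D_def tall_Suc)
  moreover have "W.prob (space ?W - {\<omega>. tall (Suc m) \<omega>}) = 1 - W.prob {\<omega>. tall (Suc m) \<omega>}"
    by (intro W.prob_compl) (use measurable_tall[of "Suc m"] in \<open>simp add: pred_def sets_offspring_space space_PiM\<close>)
  moreover have "(\<lambda>n. pmf p n * (1 - q) ^ n) sums (\<integral>k. (1 - q) ^ k \<partial>measure_pmf p)"
  proof -
    have q: "0 \<le> q" "q \<le> 1"
      by (auto simp: q_def)
    have "integrable (measure_pmf p) (\<lambda>k. (1 - q) ^ k)"
      using q by (intro measure_pmf.integrable_const_bound[where B = 1]) (auto intro!: AE_I2 power_le_one)
    then have "integrable (count_space UNIV) (\<lambda>n. pmf p n * (1 - q) ^ n)"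
      by (simp add: measure_pmf_eq_density integrable_density)
    from sums_integral_count_space_nat[OF this] show ?thesis
      by (simp add: measure_pmf_eq_density integral_density)
  qed
  ultimately have "1 - W.prob {\<omega>. tall (Suc m) \<omega>} = (\<integral>k. (1 - q) ^ k \<partial>measure_pmf p)"
    unfolding D_prob by (simp add: sums_unique2)
  then show ?thesis
    by (simp add: q_def)
qed

section \<open>Heights of the bushes along the spine\<close>

text \<open>Heights are counted from the child off the spine, so the vertex found has length
  \<open>k + 1 + m\<close>. All labels are read from \<omega>, as the subtree of such a child misses
  the spine.\<close>

definition bush_tall :: "nat \<Rightarrow> nat \<Rightarrow> (nat \<Rightarrow> nat \<times> nat) \<Rightarrow> (nat list \<Rightarrow> nat) \<Rightarrow> bool" where
  "bush_tall k m \<sigma> \<omega> \<longleftrightarrow> (\<exists>j<fst (\<sigma> k). j \<noteq> snd (\<sigma> k) \<and> tall m (\<lambda>u. \<omega> ((spine \<sigma> k @ [j]) @ u)))"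

context spine_tree
begin

text \<open>Let \<open>s k\<close> be the last spine vertex among the prefixes of \<open>x\<close>.
  Then \<open>k < n\<close>, and at least \<open>m\<close> letters of \<open>x\<close> follow the
  step off the spine.\<close>

lemma bush_tall_if_long:
  assumes x: "x \<in> V" "take n x \<noteq> s n" "n + m \<le> length x"
  shows "\<exists>k<n. bush_tall k m \<sigma> \<omega>"
proof -
  define l where "l = (LEAST i. take i x \<noteq> s i)"
  have l: "take l x \<noteq> s l" and ln: "l \<le> n"
    unfolding l_def using LeastI[of "\<lambda>i. take i x \<noteq> s i", OF x(2)] Least_le[of "\<lambda>i. take i x \<noteq> s i", OF x(2)]
    by simp_all
  have "l \<noteq> 0"
    using l by (intro notI) (simp add: spine_def)
  then obtain k where k: "l = Suc k"
    by (cases l) auto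
  have tk: "take k x = s k"
    using not_less_Least[of k "\<lambda>i. take i x \<noteq> s i"] k by (auto simp: l_def)
  have kn: "k < n"
    using ln k by simp
  then have kx: "k < length x"
    using x(3) by simp
  define j where "j = x ! k"
  have tSk: "take (Suc k) x = s k @ [j]"
    using kx tk by (simp add: take_Suc_conv_app_nth j_def)
  have x_iff: "x ! i < offspring (take i x)" if "i < length x" for i
    using x(1) that by (simp add: V_eq uh_tree_iff)
  have "j < fst (\<sigma> k)"
    using x_iff[OF kx] tk by (simp add: offspring_def j_def)
  moreover have "j \<noteq> snd (\<sigma> k)"
    using l tSk k by (auto simp: spine_Suc)
  moreover have "tall m (\<lambda>u. \<omega> ((s k @ [j]) @ u))"
  proof -
    define u where "u = take m (drop (Suc k) x)"
    have len: "length u = m"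
      using x(3) kn by (simp add: u_def)
    have "u ! i < \<omega> ((s k @ [j]) @ take i u)" if i: "i < m" for i
    proof -
      have "take (Suc k + i) x = take (Suc k) x @ take i (drop (Suc k) x)"
        by (rule take_add)
      also have "\<dots> = (s k @ [j]) @ take i u"
        using i by (simp only: tSk) (simp add: u_def min_def)
      finally have t: "take (Suc k + i) x = (s k @ [j]) @ take i u" .
      have lt: "Suc k + i < length x"
        using i x(3) kn by simp
      \<comment> \<open>A path that has left the spine stays off it, so \<open>offspring\<close>
        reads from \<omega> here.\<close>
      have "take (Suc k + i) x \<noteq> s (Suc k + i)"
      proof
        assume "take (Suc k + i) x = s (Suc k + i)"
        then have "take (Suc k) (take (Suc k + i) x) = take (Suc k) (s (Suc k + i))"
          by simp
        then show False
          using l k by (simp add: take_spine min_def)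
      qed
      moreover have "length (take (Suc k + i) x) = Suc k + i"
        using lt by simp
      ultimately have "offspring (take (Suc k + i) x) = \<omega> ((s k @ [j]) @ take i u)"
        unfolding offspring_def by (metis t)
      moreover have "u ! i = x ! (Suc k + i)"
        using i x(3) kn by (simp add: u_def)
      ultimately show ?thesis
        using x_iff[OF lt] by simp
    qed
    then have "u \<in> uh_tree (\<lambda>u. \<omega> ((s k @ [j]) @ u))"
      by (simp add: uh_tree_iff len)
    then show ?thesis
      using len by (auto simp: tall_def)
  qed
  ultimately show ?thesis
    using kn by (auto simp: bush_tall_def)
qed

end

section \<open>Random spine and random bushes\<close>

definition spine_space :: "nat pmf \<Rightarrow> (nat \<Rightarrow> nat \<times> nat) measure" where
  "spine_space p = (\<Pi>\<^sub>M n\<in>UNIV. measure_pmf (spine_pmf p))"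

lemma sets_spine_space [measurable_cong]:
  "sets (spine_space p) = sets (\<Pi>\<^sub>M n\<in>UNIV. count_space UNIV)"
  unfolding spine_space_def by (intro sets_PiM_cong) auto

lemma space_spine_space [simp]: "space (spine_space p) = UNIV"
  by (simp add: spine_space_def space_PiM)

lemma prob_space_spine_space: "prob_space (spine_space p)"
  unfolding spine_space_def by (intro prob_space_PiM prob_space_measure_pmf)

lemma surviving_space_eq: "surviving_space p = spine_space p \<Otimes>\<^sub>M offspring_space p"
  by (simp add: surviving_space_def spine_space_def offspring_space_def)

lemma measurable_spine [measurable]:
  "(\<lambda>\<sigma>. spine \<sigma> k) \<in> (\<Pi>\<^sub>M n\<in>UNIV. count_space UNIV) \<rightarrow>\<^sub>M count_space UNIV"
proof (induction k)
  case 0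
  then show ?case
    by (simp add: spine_def)
next
  case (Suc k)
  note [measurable] = Suc
  show ?case
    unfolding spine_Suc by measurable
qed

lemma measurable_shift_offspring:
  "(\<lambda>\<omega> u. \<omega> (w @ u)) \<in> (\<Pi>\<^sub>M u\<in>UNIV. count_space (UNIV :: nat set)) \<rightarrow>\<^sub>M (\<Pi>\<^sub>M u\<in>UNIV. count_space UNIV)"
  by (intro measurable_PiM_single') auto

text \<open>The address at which \<omega> is read depends on the spine; a countable quantifier over
  its value \<open>w\<close> freezes it.\<close>

lemma measurable_bush_tall [measurable]:
  "Measurable.pred (spine_space p \<Otimes>\<^sub>M offspring_space p) (\<lambda>e. bush_tall k m (fst e) (snd e))"
proof -
  have [measurable]: "Measurable.pred (offspring_space p) (\<lambda>\<omega>. tall m (\<lambda>u. \<omega> (w @ u)))" for w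
    using measurable_compose[OF measurable_shift_offspring measurable_tall] by measurable
  have "(\<lambda>e. bush_tall k m (fst e) (snd e)) = (\<lambda>e. \<exists>w j. w = spine (fst e) k \<and> j < fst (fst e k) \<and>
     j \<noteq> snd (fst e k) \<and> tall m (\<lambda>u. snd e ((w @ [j]) @ u)))"
    by (auto simp: bush_tall_def fun_eq_iff)
  also have "Measurable.pred (spine_space p \<Otimes>\<^sub>M offspring_space p) \<dots>"
    by measurable
  finally show ?thesis .
qed

context critical_offspring
begin

lemma set_pmf_size_biased: "k \<in> set_pmf (size_biased p) \<Longrightarrow> k > 0"
  by (auto simp: set_pmf_iff pmf_size_biased[OF mean_offspring])

lemma set_pmf_spine_pmf: "z \<in> set_pmf (spine_pmf p) \<Longrightarrow> snd z < fst z"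
  unfolding spine_pmf_def using set_pmf_size_biased
  by (auto simp: set_pmf_of_set lessThan_empty_iff)

lemma map_fst_spine_pmf: "map_pmf fst (spine_pmf p) = size_biased p"
  by (simp add: spine_pmf_def map_bind_pmf pmf.map_comp comp_def map_pmf_const bind_return_pmf')

lemma AE_spine_valid: "AE \<sigma> in spine_space p. \<forall>n. snd (\<sigma> n) < fst (\<sigma> n)"
proof (subst AE_all_countable, intro allI)
  fix n
  show "AE \<sigma> in spine_space p. snd (\<sigma> n) < fst (\<sigma> n)"
    unfolding spine_space_def
    by (rule AE_PiM_component[where P = "\<lambda>z. snd z < fst z"])
      (auto intro: prob_space_measure_pmf simp: AE_measure_pmf_iff set_pmf_spine_pmf)
qed

definition height_prob :: "nat \<Rightarrow> real" where
  "height_prob m = measure (offspring_space p) {\<omega>. tall m \<omega>}"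

lemma height_prob_range: "0 \<le> height_prob m" "height_prob m \<le> 1"
proof -
  interpret prob_space "offspring_space p" by (rule prob_space_offspring_space)
  show "0 \<le> height_prob m" "height_prob m \<le> 1"
    by (auto simp: height_prob_def)
qed

lemma height_prob_Suc: "height_prob (Suc m) = height_prob m - pmf_excess p (height_prob m)"
  using prob_tall_Suc[of p m] pmf_excess_eq[OF height_prob_range] by (simp add: height_prob_def)

lemma emeasure_bush_tall_section:
  assumes "snd (\<sigma> k) < fst (\<sigma> k)"
  shows "emeasure (offspring_space p) {\<omega>. bush_tall k m \<sigma> \<omega>} \<le>
    ennreal (min 1 (real (fst (\<sigma> k) - 1) * height_prob m))"
proof -
  interpret prob_space "offspring_space p" by (rule prob_space_offspring_space)
  let ?J = "{..<fst (\<sigma> k)} - {snd (\<sigma> k)}"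
  let ?T = "\<lambda>j. {\<omega>. tall m (\<lambda>u. \<omega> ((spine \<sigma> k @ [j]) @ u))}"
  have T: "?T j \<in> events" for j
    using measurable_compose[OF measurable_shift_offspring measurable_tall[of m], of "spine \<sigma> k @ [j]"]
    unfolding pred_def by (simp add: sets_offspring_space space_PiM)
  have eq: "{\<omega>. bush_tall k m \<sigma> \<omega>} = (\<Union>j\<in>?J. ?T j)"
    by (auto simp: bush_tall_def)
  have "prob (\<Union>j\<in>?J. ?T j) \<le> (\<Sum>j\<in>?J. prob (?T j))"
    using T by (intro finite_measure_subadditive_finite) auto
  also have "\<dots> = real (card ?J) * height_prob m"
    unfolding prob_tall_shift height_prob_def by simp
  also have "card ?J = fst (\<sigma> k) - 1"
    using assms by (simp add: card_Diff_singleton)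
  finally show ?thesis
    unfolding eq emeasure_eq_measure by (intro ennreal_leI) simp
qed

text \<open>Conditionally on the spine the union bound of the previous lemma applies; the number of
  children of a spine vertex, over which it is then averaged, is size-biased.\<close>

lemma emeasure_bush_tall:
  "emeasure (surviving_space p) {e. bush_tall k m (fst e) (snd e)} \<le>
    ennreal (4 * (pmf_excess p (height_prob m) / height_prob m))"
proof -
  interpret S: prob_space "spine_space p" by (rule prob_space_spine_space)
  interpret W: prob_space "offspring_space p" by (rule prob_space_offspring_space)
  interpret pair_prob_space "spine_space p" "offspring_space p" ..
  let ?A = "{e. bush_tall k m (fst e) (snd e)}"
  let ?f = "\<lambda>N. ennreal (min 1 (real (N - 1) * height_prob m))"
  have A: "?A \<in> sets (spine_space p \<Otimes>\<^sub>M offspring_space p)"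
    using measurable_bush_tall[of k m p] unfolding pred_def by (simp add: space_pair_measure)
  have "emeasure (surviving_space p) ?A =
      (\<integral>\<^sup>+\<sigma>. emeasure (offspring_space p) (Pair \<sigma> -` ?A) \<partial>spine_space p)"
    unfolding surviving_space_eq by (rule W.emeasure_pair_measure_alt[OF A])
  also have "\<dots> \<le> (\<integral>\<^sup>+\<sigma>. ?f (fst (\<sigma> k)) \<partial>spine_space p)"
  proof (rule nn_integral_mono_AE)
    show "AE \<sigma> in spine_space p. emeasure (offspring_space p) (Pair \<sigma> -` ?A) \<le> ?f (fst (\<sigma> k))"
      using AE_spine_valid
    proof eventually_elim
      case (elim \<sigma>)
      then show ?case
        using emeasure_bush_tall_section[of \<sigma> k m] by (simp add: vimage_def)
    qed
  qed
  also have "\<dots> = (\<integral>\<^sup>+z. ?f (fst z) \<partial>distr (spine_space p) (measure_pmf (spine_pmf p)) (\<lambda>\<sigma>. \<sigma> k))"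
    by (subst nn_integral_distr) auto
  also have "distr (spine_space p) (measure_pmf (spine_pmf p)) (\<lambda>\<sigma>. \<sigma> k) = measure_pmf (spine_pmf p)"
    unfolding spine_space_def by (rule distr_PiM_component) (auto intro: prob_space_measure_pmf)
  also have "(\<integral>\<^sup>+z. ?f (fst z) \<partial>measure_pmf (spine_pmf p)) = (\<integral>\<^sup>+N. ?f N \<partial>measure_pmf (size_biased p))"
    unfolding map_fst_spine_pmf[symmetric] by simp
  also have "\<dots> \<le> ennreal (4 * (pmf_excess p (height_prob m) / height_prob m))"
  \<comment> \<open>For \<open>height_prob m = 0\<close> both sides are 0, the quotient by
    convention.\<close>
  proof (cases "height_prob m = 0")
    case False
    then show ?thesis
      using height_prob_range[of m] by (intro size_biased_integral_le) auto
  qed simp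
  finally show ?thesis .
qed

text \<open>For large \<open>n\<close>, each of \<open>n\<close> bushes reaches height
  \<open>D * n\<close> with probability at most \<open>4 * K / (D * n)\<close>, so some bush does
  with probability at most \<open>4 * K / D\<close>, free of \<open>n\<close>. Failure of
  \<open>D\<close> for all large \<open>n\<close> obeys the same bound, and failure of every
  \<open>D\<close> has probability 0.\<close>

lemma AE_infinitely_often_short_bushes:
  assumes K: "\<And>m. m \<ge> m0 \<Longrightarrow> real m * (pmf_excess p (height_prob m) / height_prob m) \<le> K"
  shows "AE e in surviving_space p. \<exists>D. \<exists>\<^sub>\<infinity>n. \<forall>k<n. \<not> bush_tall k (D * n) (fst e) (snd e)"
proof -
  interpret S: prob_space "spine_space p" by (rule prob_space_spine_space)
  interpret W: prob_space "offspring_space p" by (rule prob_space_offspring_space)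
  interpret pair_prob_space "spine_space p" "offspring_space p" ..
  note [simp] = space_pair_measure
  define bad where "bad D n = {e. \<exists>k<n. bush_tall k (D * n) (fst e) (snd e)}" for D n
  have bad_sets [measurable]: "bad D n \<in> events" for D n
  proof -
    have "Measurable.pred (spine_space p \<Otimes>\<^sub>M offspring_space p) (\<lambda>e. \<exists>k\<in>{..<n}. bush_tall k (D * n) (fst e) (snd e))"
      by measurable
    then show ?thesis
      by (simp add: pred_def bad_def Bex_def)
  qed
  have bad_prob: "prob (bad D n) \<le> 4 * K / real D" if "D > 0" "n > 0" "n \<ge> m0" for D n
  proof -
    let ?r = "pmf_excess p (height_prob (D * n)) / height_prob (D * n)"
    have single: "{e. bush_tall k (D * n) (fst e) (snd e)} \<in> events" for k
      using measurable_bush_tall[of k "D * n" p] unfolding pred_def by simp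
    have r0: "?r \<ge> 0"
      using pmf_excess_range(1)[OF height_prob_range] height_prob_range by simp
    have "prob (bad D n) = prob (\<Union>k\<in>{..<n}. {e. bush_tall k (D * n) (fst e) (snd e)})"
      by (intro arg_cong[where f = prob]) (auto simp: bad_def)
    also have "\<dots> \<le> (\<Sum>k<n. prob {e. bush_tall k (D * n) (fst e) (snd e)})"
      using single by (intro finite_measure_subadditive_finite) auto
    also have "\<dots> \<le> (\<Sum>k<n. 4 * ?r)"
      using emeasure_bush_tall[of _ "D * n"] r0
      by (intro sum_mono) (simp add: surviving_space_eq emeasure_eq_measure)
    also have "\<dots> = 4 * (real (D * n) * ?r) / real D"
      using that by simp
    also have "\<dots> \<le> 4 * K / real D"
      using that by (intro divide_right_mono mult_left_mono K) (auto intro: order_trans[of _ n])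
    finally show ?thesis .
  qed
  define F where "F D = (\<Union>N. \<Inter>n\<in>{N..}. bad D n)" for D
  have F_sets: "F D \<in> events" for D
    unfolding F_def by measurable
  have F_prob: "prob (F D) \<le> 4 * K / real D" if "D > 0" for D
  proof -
    have "(\<lambda>N. prob (\<Inter>n\<in>{N..}. bad D n)) \<longlonglongrightarrow> prob (F D)"
      unfolding F_def by (rule finite_Lim_measure_incseq) (auto simp: incseq_def)
    moreover have "prob (\<Inter>n\<in>{N..}. bad D n) \<le> 4 * K / real D" for N
    proof -
      have "prob (\<Inter>n\<in>{N..}. bad D n) \<le> prob (bad D (Suc (max N m0)))"
        by (intro finite_measure_mono) auto
      also have "\<dots> \<le> 4 * K / real D"
        using that by (intro bad_prob) auto
      finally show ?thesis .
    qed
    ultimately show ?thesis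
      by (intro LIMSEQ_le_const2) auto
  qed
  \<comment> \<open>\<open>D\<close> starts at 1, as the bound \<open>4 * K / D\<close> needs
    \<open>D > 0\<close>.\<close>
  let ?N = "\<Inter>D\<in>{1..}. F D"
  have N_sets: "?N \<in> events"
    using F_sets by measurable
  have "prob ?N \<le> 4 * K / real (Suc D)" for D
  proof -
    have "prob ?N \<le> prob (F (Suc D))"
      using F_sets by (intro finite_measure_mono) auto
    then show ?thesis
      using F_prob[of "Suc D"] by linarith
  qed
  moreover have "(\<lambda>D. 4 * K / real (Suc D)) \<longlonglongrightarrow> 0"
    using tendsto_mult[OF tendsto_const[of "4 * K"] LIMSEQ_inverse_real_of_nat] by (simp add: divide_inverse)
  ultimately have "prob ?N \<le> 0"
    by (intro LIMSEQ_le_const) auto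
  then have "prob ?N = 0"
    by (simp add: measure_le_0_iff)
  then have "AE e in spine_space p \<Otimes>\<^sub>M offspring_space p. e \<notin> ?N"
    using N_sets prob_eq_0 by blast
  then show ?thesis
    unfolding surviving_space_eq
  proof eventually_elim
    case (elim e)
    then obtain D where "e \<notin> F D"
      by auto
    then have "\<forall>N. \<exists>n\<ge>N. e \<notin> bad D n"
      by (auto simp: F_def)
    then show ?case
      unfolding INFM_nat_le bad_def by blast
  qed
qed

text \<open>Positivity and the halving inequality with a factor below 1/2 are all that is taken from
  regular variation.\<close>

lemma AE_infinite_collision_property:
  assumes \<delta>: "\<delta> > 0" "\<And>q. 0 < q \<Longrightarrow> q < \<delta> \<Longrightarrow> 0 < pmf_excess p q \<and> pmf_excess p (q / 2) \<le> \<theta> * pmf_excess p q"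
    and \<theta>: "\<theta> < 1 / 2"
  shows "AE e in surviving_space p. infinite_collision_property (surviving_tree e) uh_adj"
proof -
  interpret W: prob_space "offspring_space p" by (rule prob_space_offspring_space)
  interpret S: prob_space "spine_space p" by (rule prob_space_spine_space)
  interpret pair_prob_space "spine_space p" "offspring_space p" ..
  have "\<exists>K m0. \<forall>m\<ge>m0. real m * (pmf_excess p (height_prob m) / height_prob m) \<le> K"
    by (rule iteration_ratio_bound[OF convex_on_pmf_excess _ pmf_excess_ratio_mono \<delta> \<theta>])
      (auto simp: pmf_excess_range height_prob_range height_prob_Suc)
  then obtain K m0 where "\<And>m. m \<ge> m0 \<Longrightarrow> real m * (pmf_excess p (height_prob m) / height_prob m) \<le> K"
    by blast
  from AE_infinitely_often_short_bushes[OF this]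
  have "AE e in surviving_space p. \<exists>D. \<exists>\<^sub>\<infinity>n. \<forall>k<n. \<not> bush_tall k (D * n) (fst e) (snd e)" .
  moreover have "AE e in surviving_space p. \<forall>n. snd (fst e n) < fst (fst e n)"
    unfolding surviving_space_eq
  proof (rule AE_distrD[of fst _ "spine_space p"])
    show "AE \<sigma> in distr (spine_space p \<Otimes>\<^sub>M offspring_space p) (spine_space p) fst.
        \<forall>n. snd (\<sigma> n) < fst (\<sigma> n)"
      unfolding W.distr_pair_fst by (rule AE_spine_valid)
  qed simp
  ultimately show ?thesis
  proof eventually_elim
    case (elim e)
    interpret spine_tree "fst e" "snd e"
      by unfold_locales (use elim in auto)
    obtain D where D: "\<exists>\<^sub>\<infinity>n. \<forall>k<n. \<not> bush_tall k (D * n) (fst e) (snd e)"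
      using elim by blast
    \<comment> \<open>\<open>Suc D\<close> allows for \<open>n\<close> letters along the spine and
      \<open>D * n\<close> inside the bush.\<close>
    have "\<exists>\<^sub>\<infinity>n. \<forall>x\<in>surviving_tree (fst e, snd e). take n x \<noteq> spine (fst e) n \<longrightarrow> length x \<le> Suc D * n"
      using D
    proof (rule INFM_mono)
      fix n assume n: "\<forall>k<n. \<not> bush_tall k (D * n) (fst e) (snd e)"
      show "\<forall>x\<in>surviving_tree (fst e, snd e). take n x \<noteq> spine (fst e) n \<longrightarrow> length x \<le> Suc D * n"
      proof (intro ballI impI, rule ccontr)
        fix x assume "x \<in> surviving_tree (fst e, snd e)" "take n x \<noteq> spine (fst e) n" "\<not> length x \<le> Suc D * n"
        then show False
          using bush_tall_if_long[of x n "D * n"] n by auto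
      qed
    qed
    from infinite_collision_property_if_short_bushes[OF this] show ?case
      by simp
  qed
qed

end

section \<open>From regular variation to the halving inequality\<close>

theorem corollary3p5:
  fixes M :: "'a measure" and p :: "nat pmf" and Z :: "nat \<Rightarrow> 'a \<Rightarrow> nat"
    and \<alpha> :: real and L :: "real \<Rightarrow> real"
  assumes GW: "galton_watson M p Z"
    and critical: "integrable M (\<lambda>\<omega>. real (Z 1 \<omega>))" "(\<integral>\<omega>. real (Z 1 \<omega>) \<partial>M) = 1"
    and infinite_variance:
      "(\<integral>\<^sup>+\<omega>. ennreal ((real (Z 1 \<omega>) - (\<integral>\<omega>'. real (Z 1 \<omega>') \<partial>M))\<^sup>2) \<partial>M) = \<infinity>"
    and alpha: "1 < \<alpha>" "\<alpha> \<le> 2"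
    and slowly_varying: "slowly_varying_at_0 L"
    and gen_fun: "\<And>s::real. 0 \<le> s \<Longrightarrow> s < 1 \<Longrightarrow>
      (\<integral>\<omega>. s ^ Z 1 \<omega> \<partial>M) = s + (1 - s) powr \<alpha> * L (1 - s)"
  shows "AE e in surviving_space p. infinite_collision_property (surviving_tree e) uh_adj"
proof -
  obtain \<xi> :: "nat \<Rightarrow> nat \<Rightarrow> 'a \<Rightarrow> nat" where
    indep: "prob_space.indep_vars M (\<lambda>_. count_space UNIV) (\<lambda>(n, i). \<xi> n i) UNIV"
    and law: "\<And>n i. distr M (count_space UNIV) (\<xi> n i) = measure_pmf p"
    and Z: "\<And>\<omega>. \<omega> \<in> space M \<Longrightarrow> Z 0 \<omega> = 1 \<and> (\<forall>n. Z (Suc n) \<omega> = (\<Sum>i<Z n \<omega>. \<xi> n i \<omega>))"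
    and "prob_space M"
    using GW unfolding galton_watson_def by blast
  interpret prob_space M by fact
  have \<xi>: "\<xi> 0 0 \<in> M \<rightarrow>\<^sub>M count_space UNIV"
    using indep unfolding indep_vars_def by (auto dest!: conjunct1 spec[where x = "(0, 0)"])
  have Z1: "Z 1 \<omega> = \<xi> 0 0 \<omega>" if "\<omega> \<in> space M" for \<omega>
    using Z[OF that] by simp
  \<comment> \<open>\<open>Z 1\<close> has law \<open>p\<close>, so the hypotheses on the process
    become hypotheses on \<open>p\<close>.\<close>
  have integral_Z1: "(\<integral>\<omega>. g (Z 1 \<omega>) \<partial>M) = (\<integral>k. g k \<partial>measure_pmf p)" for g :: "nat \<Rightarrow> real"
  proof -
    have "(\<integral>\<omega>. g (Z 1 \<omega>) \<partial>M) = (\<integral>\<omega>. g (\<xi> 0 0 \<omega>) \<partial>M)"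
      by (intro Bochner_Integration.integral_cong) (auto simp: Z1[unfolded One_nat_def])
    also have "\<dots> = (\<integral>k. g k \<partial>distr M (count_space UNIV) (\<xi> 0 0))"
      by (rule integral_distr[symmetric, OF \<xi>]) simp
    finally show ?thesis
      by (simp add: law)
  qed
  interpret critical_offspring p
  proof
    show "measure_pmf.expectation p real = 1"
      using critical(2) integral_Z1[of real] by simp
    then show "integrable (measure_pmf p) real"
      using not_integrable_integral_eq by fastforce
  qed
  have excess: "pmf_excess p q = q powr \<alpha> * L q" if "0 < q" "q \<le> 1" for q
    using gen_fun[of "1 - q"] integral_Z1[of "\<lambda>k. (1 - q) ^ k"] pmf_excess_eq[of q] that by simp
  obtain \<delta>0 where \<delta>0: "\<delta>0 > 0" "\<And>t. 0 < t \<Longrightarrow> t < \<delta>0 \<Longrightarrow> L t > 0"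
    and ratio: "\<And>c. c > 0 \<Longrightarrow> ((\<lambda>t. L (c * t) / L t) \<longlongrightarrow> 1) (at_right 0)"
    using slowly_varying unfolding slowly_varying_at_0_def by auto
  \<comment> \<open>The midpoint of \<open>2 powr (- \<alpha>)\<close> and \<open>1 / 2\<close>,
    where \<alpha> > 1 makes the former smaller. By slow variation with factor \<open>1 / 2\<close>,
    the quotient of \<phi> at \<open>q / 2\<close> and at \<open>q\<close> tends to
    \<open>2 powr (- \<alpha>)\<close>, hence is eventually below \<theta>.\<close>
  define \<theta> where "\<theta> = (2 powr (- \<alpha>) + 1 / 2) / 2"
  have "2 powr (- \<alpha>) < 2 powr (- 1)"
    using alpha by (intro powr_less_mono) auto
  then have "2 powr (- \<alpha>) < 1 / 2"
    by (simp add: powr_minus_divide)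
  then have \<theta>: "\<theta> < 1 / 2" "2 powr (- \<alpha>) < \<theta>"
    by (simp_all add: \<theta>_def)
  then have "1 < \<theta> * 2 powr \<alpha>"
    by (simp add: powr_minus_divide divide_less_eq)
  from order_tendstoD(2)[OF ratio[of "1 / 2"] this]
  have "\<forall>\<^sub>F t in at_right 0. L (1 / 2 * t) / L t < \<theta> * 2 powr \<alpha>"
    by simp
  then obtain \<delta>1 where \<delta>1: "\<delta>1 > 0" "\<And>t. 0 < t \<Longrightarrow> t < \<delta>1 \<Longrightarrow> L (t / 2) / L t < \<theta> * 2 powr \<alpha>"
    by (auto simp: eventually_at_right_field)
  \<comment> \<open>The formula \<open>excess\<close> holds up to 1, positivity of \<open>L\<close>
    below \<open>\<delta>0\<close>, and the ratio bound below \<open>\<delta>1\<close>.\<close>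
  define \<delta> where "\<delta> = min 1 (min \<delta>0 \<delta>1)"
  show ?thesis
  proof (rule AE_infinite_collision_property[of \<delta> \<theta>])
    show "\<delta> > 0"
      using \<delta>0 \<delta>1 by (simp add: \<delta>_def)
    fix q assume q: "0 < q" "q < \<delta>"
    have Lq: "L q > 0"
      using \<delta>0(2) q by (simp add: \<delta>_def)
    have "L (q / 2) \<le> \<theta> * 2 powr \<alpha> * L q"
      using \<delta>1(2)[of q] q Lq by (simp add: \<delta>_def divide_less_eq)
    then have "(q / 2) powr \<alpha> * L (q / 2) \<le> (q / 2) powr \<alpha> * (\<theta> * 2 powr \<alpha> * L q)"
      by (intro mult_left_mono) auto
    also have "\<dots> = \<theta> * (q powr \<alpha> * L q)"
      using q by (simp add: powr_divide)
    finally show "0 < pmf_excess p q \<and> pmf_excess p (q / 2) \<le> \<theta> * pmf_excess p q"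
      using q Lq by (simp add: excess \<delta>_def)
  qed (rule \<theta>)
qed

end
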